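(* Let $h\ge 0$ be an integer and let $z\in\mathbb C$ with $|z|=1$. In the setting described in the context, suppose that the off-diagonal block $C(z)$ of $\varphi(z)$ is a constant dyad, $C(z)=uv^{\top}$ with $u\in\mathbb C^{p}$, $v\in\mathbb C^{m-p}$ independent of $z$. Then $-\widetilde C^{(h)}(z^{2^h})$ is the sum of the following four outer products: \[ \begin{aligned} -\widetilde C^{(h)}(z^{2^h})=\Big[&\mathcal{KM}_{2^h}(\widehat G_D,\widehat a)\,\mathcal{KM}_{2^h}(\widehat R^{\top},\widehat b)^{\top} +z^{2^h-1}\,\mathcal{KM}_{2^h}(\widehat G_D,\widehat a)\,J\,\mathcal{KM}_{2^h}(R^{\top},b)^{\top}\\ &+z^{1-2^h}\,\mathcal{KM}_{2^h}(G_D,a)\,J\,\mathcal{KM}_{2^h}(\widehat R^{\top},\widehat b)^{\top} +\mathcal{KM}_{2^h}(G_D,a)\,\mathcal{KM}_{2^h}(R^{\top},b)^{\top}\Big]\begin{bmatrix} I\\ 0\end{bmatrix}, \end{aligned} \] where $\begin{bmatrix} I\\0\end{bmatrix}\in\mathbb C^{m\times(m-p)}$, $\widehat v=\begin{bmatrix}v\\0\end{bmatrix}\in\mathbb C^m$, and \[ a=\Big(\sum_{s\in 2^h\mathbb Z\cap\mathbb N}z^{-s-1}G_D^{s+1}\Big)H_{D,0}u,\qquad b=\Big(\sum_{s\in 2^h\mathbb Z\cap\mathbb N}z^{s+1}R^{s+1}\Big)^{\top}H_{\psi,0}^{\top}\widehat v, \] \[ \widehat a=\Big(\sum_{s\in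 2^h\mathbb Z\cap\mathbb N}z^{s}\widehat G_D^{s}\Big)H_{D,0}u,\qquad \widehat b=\Big(\sum_{s\in 2^h\mathbb Z\cap\mathbb N}z^{-s}\widehat R^{s}\Big)^{\top}H_{\psi,0}^{\top}\widehat v . \]
   Context: Notation: $\mathbb N=\{0,1,2,\dots\}$; superscript $\top$ is (non-conjugate) transposition; $J$ is the counter-identity matrix (ones on the anti-diagonal) of appropriate size; for a square matrix $M$ and vector $w$, $\mathcal{KM}_{n}(M,w)=[\,w\,|\,Mw\,|\cdots|\,M^{n-1}w\,]$ is the Krylov matrix with $n$ columns. Cyclic reduction (CR). Let $A_{-1},A_0,A_1\in\mathbb C^{m\times m}$, $A_i^{(0)}=A_i$, and for $h\ge0$, with $S^{(h)}=(A_0^{(h)})^{-1}$, $A_0^{(h+1)}=A_0^{(h)}-A_1^{(h)}S^{(h)}A_{-1}^{(h)}-A_{-1}^{(h)}S^{(h)}A_1^{(h)}$, $A_1^{(h+1)}=-A_1^{(h)}S^{(h)}A_1^{(h)}$, $A_{-1}^{(h+1)}=-A_{-1}^{(h)}S^{(h)}A_{-1}^{(h)}$. All $A_0^{(h)}$ are assumed invertible (CR has no breakdown). Put $\varphi(z)=z^{-1}A_{-1}+A_0+zA_1$, $\psi(z)=\varphi(z)^{-1}$, $\varphi_h(z)=z^{-1}A^{(h)}_{-1}+A^{(h)}_0+zA^{(h)}_1$, $\psi^{(h)}(z)=\varphi_h(z)^{-1}$. Splitting. The eigenvalues of an $m\times m$ matrix Laurent polynomial $\varphi(z)=z^{-1}A_{-1}+A_0+zA_1$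 are the $2m$ roots of $\det(A_{-1}+zA_0+z^2A_1)$, where roots at infinity are added if the degree is less than $2m$. The splitting property with radius $t\in(0,1)$ is $|\xi_1|\le\dots\le|\xi_m|<t<1<t^{-1}<|\xi_{m+1}|\le\dots\le|\xi_{2m}|$. It is assumed for $\varphi$ (with $2m$ eigenvalues). Blocks. Partition $\varphi(z)=\begin{pmatrix}A(z)&B(z)\\ C(z)&D(z)\end{pmatrix}$ with square diagonal blocks, $D(z)$ of size $p\times p$, and partition $\psi(z)$ and $\psi^{(h)}(z)$ conformally; $\widetilde C(z)$ and $\widetilde C^{(h)}(z)$ denote their lower-left $p\times(m-p)$ blocks. The splitting property (with $2p$ eigenvalues) is also assumed for the Laurent polynomial $D(z)=z^{-1}D_{-1}+D_0+zD_1$; hence $\varphi$ and $D$ are invertible on an annulus containing the unit circle. Solvents. It is assumed that there exist $R,\widehat R$ of spectral radius less than $1$ with $A_1+RA_0+R^2A_{-1}=0$ and $\widehat R^2A_1+\widehat RA_0+A_{-1}=0$, and likewise for $D(z)$ in place of $\varphi(z)$. Write $\psi(z)=\sum_{j\in\mathbb Z}z^jH_{\psi,j}$ and $D(z)^{-1}=\sum_{j\in\mathbb Z}z^jH_{D,j}$ for the Laurent expansions on the annulus. $G_D,\widehat G_D$ are the matrices of spectral radius less than $1$ solving $D_1X^2+D_0X+D_{-1}=0$ and $D_1+D_0X+D_{-1}X^2=0$, respectively. It is known (and may be used) that $H_{\psi,j}=H_{\psi,0}\widehat R^{-j}$ for $j\le0$, $H_{\psi,j}=H_{\psi,0}R^{j}$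 for $j\ge0$, $H_{D,j}=G_D^{-j}H_{D,0}$ for $j\le 0$, $H_{D,j}=\widehat G_D^{j}H_{D,0}$ for $j\ge0$. It is also known that $\psi^{(h)}(z^{2^h})=\frac1{2^h}\sum_{j=1}^{2^h}\psi(\zeta^jz)$ with $\zeta$ a primitive $2^h$-th root of unity. *)

theory Defs
  imports
    "HOL-Library.Extended_Real"
    "HOL-Analysis.Infinite_Sum"
    "Jordan_Normal_Form.Spectral_Radius"
    "Jordan_Normal_Form.Gauss_Jordan_Elimination"
begin

(* Matrices are the explicit-dimension matrices of Jordan_Normal_Form, so that the block sizes
   and the number 2^h of Krylov columns are ordinary natural numbers. *)

(* Unspecified for singular matrices. *)
definition minv :: "complex mat \<Rightarrow> complex mat" where
  "minv M = the (mat_inverse M)"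

(* z^(-1) Bm + B0 + z B1; only meaningful for z different from 0. *)
definition laurent_eval :: "complex mat \<Rightarrow> complex mat \<Rightarrow> complex mat \<Rightarrow> complex \<Rightarrow> complex mat" where
  "laurent_eval Bm B0 B1 z = inverse z \<cdot>\<^sub>m Bm + B0 + z \<cdot>\<^sub>m B1"

(* The triple (A_{-1}^(h), A_0^(h), A_1^(h)). *)
primrec cr :: "complex mat \<Rightarrow> complex mat \<Rightarrow> complex mat \<Rightarrow> nat \<Rightarrow> complex mat \<times> complex mat \<times> complex mat"
where
  "cr Am A0 A1 0 = (Am, A0, A1)"
| "cr Am A0 A1 (Suc h) =
     (let (Bm, B0, B1) = cr Am A0 A1 h; S = minv B0
      in (- (Bm * S * Bm), B0 - B1 * S * Bm - Bm * S * B1, - (B1 * S * B1)))"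

definition cr_mid :: "complex mat \<Rightarrow> complex mat \<Rightarrow> complex mat \<Rightarrow> nat \<Rightarrow> complex mat" where
  "cr_mid Am A0 A1 h = fst (snd (cr Am A0 A1 h))"

definition cr_no_breakdown :: "complex mat \<Rightarrow> complex mat \<Rightarrow> complex mat \<Rightarrow> bool" where
  "cr_no_breakdown Am A0 A1 \<longleftrightarrow> (\<forall>h. invertible_mat (cr_mid Am A0 A1 h))"

definition cr_phi :: "complex mat \<Rightarrow> complex mat \<Rightarrow> complex mat \<Rightarrow> nat \<Rightarrow> complex \<Rightarrow> complex mat" where
  "cr_phi Am A0 A1 h z = (case cr Am A0 A1 h of (Bm, B0, B1) \<Rightarrow> laurent_eval Bm B0 B1 z)"

definition cr_psi :: "complex mat \<Rightarrow> complex mat \<Rightarrow> complex mat \<Rightarrow> nat \<Rightarrow> complex \<Rightarrow> complex mat" where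
  "cr_psi Am A0 A1 h z = minv (cr_phi Am A0 A1 h z)"

(* det (Bm + z B0 + z^2 B1) as a polynomial in z; its degree is at most 2 n. *)
definition pencil_det :: "nat \<Rightarrow> complex mat \<Rightarrow> complex mat \<Rightarrow> complex mat \<Rightarrow> complex poly" where
  "pencil_det n Bm B0 B1 = det (mat n n (\<lambda>(i, j). [:Bm $$ (i, j), B0 $$ (i, j), B1 $$ (i, j):]))"

(* The 2 n eigenvalues, counted with multiplicity; None is the eigenvalue at infinity. *)
definition laurent_eigenvalues ::
  "nat \<Rightarrow> complex mat \<Rightarrow> complex mat \<Rightarrow> complex mat \<Rightarrow> complex option multiset" where
  "laurent_eigenvalues n Bm B0 B1 =
     (let d = pencil_det n Bm B0 B1
      in image_mset Some (proots d) + replicate_mset (2 * n - degree d) None)"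

fun emod :: "complex option \<Rightarrow> ereal" where
  "emod None = \<infinity>"
| "emod (Some x) = ereal (cmod x)"

definition splitting :: "nat \<Rightarrow> real \<Rightarrow> complex mat \<Rightarrow> complex mat \<Rightarrow> complex mat \<Rightarrow> bool" where
  "splitting n t Bm B0 B1 \<longleftrightarrow>
     0 < t \<and> t < 1 \<and> pencil_det n Bm B0 B1 \<noteq> 0 \<and>
     (\<exists>\<xi>. mset \<xi> = laurent_eigenvalues n Bm B0 B1 \<and> sorted (map emod \<xi>) \<and>
          (\<forall>i < n. emod (\<xi> ! i) < ereal t) \<and>
          (\<forall>i \<in> {n..<2 * n}. ereal (1 / t) < emod (\<xi> ! i)))"

(* F(z) = sum over all integers j of z^j H_j on the annulus r < |z| < r', entry by entry. *)
definition laurent_expansion ::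
  "nat \<Rightarrow> real \<Rightarrow> real \<Rightarrow> (complex \<Rightarrow> complex mat) \<Rightarrow> (int \<Rightarrow> complex mat) \<Rightarrow> bool" where
  "laurent_expansion n r r' F H \<longleftrightarrow>
     (\<forall>j. H j \<in> carrier_mat n n) \<and>
     (\<forall>z. r < cmod z \<and> cmod z < r' \<longrightarrow>
        (\<forall>i < n. \<forall>k < n. ((\<lambda>j. z powi j * H j $$ (i, k)) has_sum F z $$ (i, k)) UNIV))"

(* Blocks of a matrix whose leading diagonal block has size k. *)
definition lower_left :: "nat \<Rightarrow> 'a mat \<Rightarrow> 'a mat" where
  "lower_left k M = (case split_block M k k of (_, _, C, _) \<Rightarrow> C)"

definition lower_right :: "nat \<Rightarrow> 'a mat \<Rightarrow> 'a mat" where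
  "lower_right k M = (case split_block M k k of (_, _, _, D) \<Rightarrow> D)"

(* The dyad u v^T, without conjugation. *)
definition dyad :: "complex vec \<Rightarrow> complex vec \<Rightarrow> complex mat" where
  "dyad u v = mat (dim_vec u) (dim_vec v) (\<lambda>(i, j). u $ i * v $ j)"

definition krylov :: "nat \<Rightarrow> complex mat \<Rightarrow> complex vec \<Rightarrow> complex mat" where
  "krylov n M w = mat_of_cols (dim_vec w) (map (\<lambda>k. (M ^\<^sub>m k) *\<^sub>v w) [0..<n])"

definition counter_id :: "nat \<Rightarrow> complex mat" where
  "counter_id n = mat n n (\<lambda>(i, j). if i + j + 1 = n then 1 else 0)"

(* Entrywise infinite sum of n x n matrices. *)
definition mat_infsum :: "nat \<Rightarrow> (nat \<Rightarrow> complex mat) \<Rightarrow> nat set \<Rightarrow> complex mat" where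
  "mat_infsum n F S = mat n n (\<lambda>(i, j). infsum (\<lambda>s. F s $$ (i, j)) S)"

end

theory Submission
  imports Defs
begin

text \<open>
The identity is the Laurent series of a product of two functions, sampled at the exponents divisible
by \<open>2 ^ h\<close>.

For a block matrix with dyadic lower left block, the lower block row of \<open>\<phi> \<psi> = I\<close> shows that the
negative of the lower left block of the inverse is the outer product of \<open>D\<^sup>-\<^sup>1 u\<close> with the first \<open>m - p\<close>
entries of \<open>\<psi>\<^sup>T vhat\<close> (\<open>lower_left_inverse_dyad\<close>). So only two vector-valued functions have to be
expanded.

For both, the coefficients of the Laurent series are \<open>Y\<^sup>i g\<close> for \<open>i \<ge> 0\<close> and \<open>X\<^sup>-\<^sup>i g\<close> for \<open>i < 0\<close>, where
\<open>g\<close> is the constant one and \<open>X\<close>, \<open>Y\<close> are \<open>G\<close>, \<open>Ghat\<close> in the first case and, in powers of \<open>1 / x\<close>, the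
transposes of \<open>R\<close>, \<open>Rhat\<close> in the second (\<open>inverse_two_sided_power_expansion\<close>). The reason is that the
solvent equations make the Laurent polynomial times the two-sided power series a constant matrix.
Invertibility of that matrix follows from invertibility of the Laurent polynomial on the circle together
with the uniqueness of the constant coefficient.

One step of cyclic reduction factors as \<open>\<phi>\<^sub>h\<^sub>+\<^sub>1 (x\<^sup>2) = \<phi>\<^sub>h (x) S \<phi>\<^sub>h (- x)\<close>, where \<open>S\<close>
is the inverse of the middle coefficient of \<open>\<phi>\<^sub>h\<close>. Since
\<open>\<phi>\<^sub>h (x) + \<phi>\<^sub>h (- x) = 2 S\<^sup>-\<^sup>1\<close>, the inverse at \<open>x\<^sup>2\<close> is the average of the inverses at \<open>x\<close> and \<open>- x\<close>
(\<open>cr_psi_average\<close>). Averaging selects even exponents, so after \<open>h\<close> steps the product series retains the pairs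
of exponents \<open>(i, k)\<close> that agree modulo \<open>2 ^ h\<close> (\<open>repeated_even_part\<close>); here the second series is written in
powers of \<open>1 / x\<close>. Grouping the pairs by their common residue \<open>j\<close> splits the double series into \<open>2 ^ h\<close>
products, and each factor consists of a part with non-negative exponents, which comes from column \<open>j\<close> of a
Krylov matrix, and a part with negative exponents, which comes from column \<open>2 ^ h - 1 - j\<close> of another one
(\<open>has_sum_two_sided_power_residue_class\<close>). Multiplying out yields the four outer products, with the
counter-identity wherever exactly one of the two indices is reflected.
\<close>

section \<open>Even parts of Laurent series on the unit circle\<close>

lemma cmod_square_root_on_circle:
  fixes y :: complex
  assumes "cmod y = 1"
  obtains x where "cmod x = 1" "x ^ 2 = y"
proof
  show "csqrt y ^ 2 = y"
    by simp
  show "cmod (csqrt y) = 1"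
    using assms by (simp add: norm_csqrt)
qed

lemma powi_even_half:
  fixes x :: complex
  assumes "even q"
  shows "x powi q = (x ^ 2) powi (q div 2)" "(- x) powi q = x powi q"
proof -
  obtain l where l: "q = 2 * l"
    using assms by blast
  show "x powi q = (x ^ 2) powi (q div 2)"
    unfolding l by (simp add: power_int_mult)
  show "(- x) powi q = x powi q"
    unfolding l by (simp add: power_int_mult)
qed

lemma powi_odd_minus:
  fixes x :: complex
  assumes "odd q"
  shows "(- x) powi q = - (x powi q)"
  using assms by (simp add: power_int_minus_left)

text \<open>Passing from \<open>f h\<close> to the average of its values at \<open>x\<close> and \<open>- x\<close> annihilates the monomials of odd
exponent and, read as a function of \<open>x ^ 2\<close>, halves the remaining exponents. After \<open>h\<close> steps exactly
the exponents divisible by \<open>2 ^ h\<close> survive. The summation index \<open>e\<close> is separate from its exponent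
\<open>w e\<close> so that a product of two Laurent series can be summed over pairs of indices.\<close>

lemma repeated_even_part:
  fixes f :: "nat \<Rightarrow> complex \<Rightarrow> complex" and w :: "'e \<Rightarrow> int" and g :: "'e \<Rightarrow> complex"
  assumes halve: "\<And>h x. cmod x = 1 \<Longrightarrow> f (Suc h) (x ^ 2) = (f h x + f h (- x)) / 2"
    and start: "\<And>x. cmod x = 1 \<Longrightarrow> ((\<lambda>e. x powi w e * g e) has_sum f 0 x) A"
    and y: "cmod y = 1"
  shows "((\<lambda>e. y powi (w e div 2 ^ h) * g e) has_sum f h y) {e \<in> A. 2 ^ h dvd w e}"
  using y
proof (induction h arbitrary: y)
  case 0
  then show ?case
    using start by simp
next
  case (Suc h)
  obtain x where x: "cmod x = 1" "x ^ 2 = y"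
    using cmod_square_root_on_circle[OF Suc.prems] .
  let ?q = "\<lambda>e. w e div 2 ^ h"
  have dvd_Suc_iff: "2 ^ Suc h dvd c \<longleftrightarrow> 2 ^ h dvd c \<and> even (c div 2 ^ h)" for c :: int
    by (metis dvd_mult_left dvd_div_iff_mult mult.commute power_Suc power_not_zero zero_neq_numeral)
  have "((\<lambda>e. (x powi ?q e * g e + (- x) powi ?q e * g e) * (1 / 2))
      has_sum (f h x + f h (- x)) * (1 / 2)) {e \<in> A. 2 ^ h dvd w e}"
    using Suc.IH[of x] Suc.IH[of "- x"] x(1)
    by (intro has_sum_cmult_left has_sum_add) auto
  also have "?this \<longleftrightarrow> ((\<lambda>e. y powi (w e div 2 ^ Suc h) * g e)
      has_sum (f h x + f h (- x)) * (1 / 2)) {e \<in> A. 2 ^ Suc h dvd w e}"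
  proof (rule has_sum_cong_neutral)
    fix e assume "e \<in> {e \<in> A. 2 ^ Suc h dvd w e} - {e \<in> A. 2 ^ h dvd w e}"
    then show "y powi (w e div 2 ^ Suc h) * g e = 0"
      using dvd_Suc_iff[of "w e"] by blast
  next
    fix e assume e: "e \<in> {e \<in> A. 2 ^ h dvd w e} - {e \<in> A. 2 ^ Suc h dvd w e}"
    then have "odd (?q e)"
      using dvd_Suc_iff[of "w e"] by blast
    then show "(x powi ?q e * g e + (- x) powi ?q e * g e) * (1 / 2) = 0"
      by (simp add: powi_odd_minus)
  next
    fix e assume "e \<in> {e \<in> A. 2 ^ h dvd w e} \<inter> {e \<in> A. 2 ^ Suc h dvd w e}"
    then have "even (?q e)"
      using dvd_Suc_iff[of "w e"] by blast
    moreover have "w e div 2 ^ Suc h = ?q e div 2"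
      by (metis mult.commute power_Suc zdiv_zmult2_eq zero_le_numeral)
    ultimately show "(x powi ?q e * g e + (- x) powi ?q e * g e) * (1 / 2)
        = y powi (w e div 2 ^ Suc h) * g e"
      using powi_even_half[of "?q e" x] x(2) by simp
  qed
  also have "(f h x + f h (- x)) * (1 / 2) = f (Suc h) y"
    using halve[OF x(1), of h] x(2) by simp
  finally show ?case .
qed

text \<open>Taking even parts of the zero function \<open>h\<close> times shows that the coefficients with index divisible by
\<open>2 ^ h\<close> have sum zero. For large \<open>h\<close> all of these indices except \<open>0\<close> lie in the tail of an absolutely
convergent series, so the coefficient at \<open>0\<close> is arbitrarily small.\<close>

lemma laurent_constant_coeff_zero:
  fixes a :: "int \<Rightarrow> complex"
  assumes zero: "\<And>x. cmod x = 1 \<Longrightarrow> ((\<lambda>j. x powi j * a j) has_sum 0) UNIV"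
  shows "a 0 = 0"
proof (rule ccontr)
  assume a0: "a 0 \<noteq> 0"
  \<comment> \<open>the zero function is its own even part\<close>
  have multiples: "(a has_sum 0) {j :: int. 2 ^ h dvd j}" for h
    using repeated_even_part[of "\<lambda>_ _. 0" "\<lambda>j. j" a UNIV 1 h] zero by simp
  have summ: "(\<lambda>j. cmod (a j)) summable_on UNIV"
    using has_sum_imp_summable[OF zero[of 1]] summable_on_iff_abs_summable_on_complex[of a UNIV]
    by simp
  then obtain F where F: "finite F"
    "dist (\<Sum>j\<in>F. cmod (a j)) (\<Sum>\<^sub>\<infinity>j. cmod (a j)) \<le> cmod (a 0) / 2"
    using infsum_finite_approximation[OF summ, of "cmod (a 0) / 2"] a0 by auto
  have tail: "(\<Sum>\<^sub>\<infinity>j\<in>- F. cmod (a j)) \<le> cmod (a 0) / 2"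
  proof -
    have "(\<Sum>\<^sub>\<infinity>j. cmod (a j)) = (\<Sum>\<^sub>\<infinity>j\<in>F. cmod (a j)) + (\<Sum>\<^sub>\<infinity>j\<in>- F. cmod (a j))"
      using infsum_Un_disjoint[of "\<lambda>j. cmod (a j)" F "- F"]
        summable_on_subset[OF summ, of F] summable_on_subset[OF summ, of "- F"] by simp
    then show ?thesis
      using F(2) infsum_finite[OF F(1), of "\<lambda>j. cmod (a j)"] unfolding dist_real_def by linarith
  qed
  obtain h where h: "\<And>j. j \<in> F \<Longrightarrow> nat \<bar>j\<bar> \<le> h"
    using F(1) finite_nat_set_iff_bounded_le[of "(\<lambda>j. nat \<bar>j\<bar>) ` F"] by auto
  let ?T = "{j :: int. 2 ^ h dvd j} - {0}"
  have sub: "?T \<subseteq> - F"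
  proof
    fix j assume "j \<in> ?T"
    then have "2 ^ h \<le> \<bar>j\<bar>"
      using dvd_imp_le_int[of j "2 ^ h"] by simp
    moreover have "int h < 2 ^ h"
      by (rule of_nat_less_two_power)
    ultimately show "j \<in> - F"
      using h[of j] unfolding nat_le_iff Compl_iff by linarith
  qed
  have "(a has_sum (0 - a 0)) ?T"
  proof -
    have s: "a summable_on ?T"
      by (rule summable_on_subset[OF has_sum_imp_summable[OF multiples[of h]]]) blast
    have "(a has_sum (infsum a ?T + a 0)) (?T \<union> {0})"
      using s by (intro has_sum_Un_disjoint has_sum_infsum has_sum_finiteI) auto
    moreover have "?T \<union> {0} = {j :: int. 2 ^ h dvd j}"
      by auto
    ultimately have "infsum a ?T + a 0 = 0"
      using has_sum_unique[OF _ multiples[of h]] by simp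
    then have "infsum a ?T = 0 - a 0"
      unfolding eq_diff_eq .
    then show ?thesis
      using has_sum_infsum[OF s] by simp
  qed
  then have "cmod (a 0) \<le> (\<Sum>\<^sub>\<infinity>j\<in>?T. cmod (a j))"
    using norm_infsum_bound[OF summable_on_subset[OF summ, of ?T]] infsumI by fastforce
  also have "\<dots> \<le> (\<Sum>\<^sub>\<infinity>j\<in>- F. cmod (a j))"
    using sub summable_on_subset[OF summ, of ?T] summable_on_subset[OF summ, of "- F"]
    by (intro infsum_mono_neutral) auto
  finally show False
    using tail a0 zero_less_norm_iff[of "a 0"] by linarith
qed

lemma has_sum_mult_Times:
  fixes f g :: "'a \<Rightarrow> complex"
  assumes f: "(f has_sum a) A" and g: "(g has_sum b) B"
  shows "((\<lambda>(i, k). f i * g k) has_sum a * b) (A \<times> B)"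
proof -
  have "f abs_summable_on A" "g abs_summable_on B"
    using f g summable_on_iff_abs_summable_on_complex has_sum_imp_summable by blast+
  then have "(\<lambda>(i, k). f i * g k) abs_summable_on A \<times> B"
    unfolding abs_summable_on_Sigma_iff
    by (auto simp: norm_mult infsum_cmult_right' abs_mult infsum_nonneg
        intro: summable_on_cmult_right summable_on_cmult_left)
  then have sum: "((\<lambda>(i, k). f i * g k) has_sum infsum (\<lambda>(i, k). f i * g k) (A \<times> B)) (A \<times> B)"
    using summable_on_iff_abs_summable_on_complex has_sum_infsum by blast
  have "((\<lambda>i. f i * b) has_sum infsum (\<lambda>(i, k). f i * g k) (A \<times> B)) A"
    by (rule has_sum_Sigma'[OF sum]) (use has_sum_cmult_right[OF g] in simp)
  with has_sum_cmult_left[OF f] have "infsum (\<lambda>(i, k). f i * g k) (A \<times> B) = a * b"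
    by (rule has_sum_unique[symmetric])
  with sum show ?thesis
    by simp
qed

lemma residue_class_pairs:
  fixes N :: nat
  assumes "N > 0"
  shows "{(i, k). int N dvd i - k} = (\<Union>j<N. {i. i mod int N = int j} \<times> {k. k mod int N = int j})"
proof (intro Set.set_eqI iffI)
  fix e :: "int \<times> int" assume "e \<in> {(i, k). int N dvd i - k}"
  then have "fst e mod int N = snd e mod int N"
    by (auto simp: mod_eq_dvd_iff)
  moreover obtain j where "j < N" "snd e mod int N = int j"
    using assms by (metis of_nat_0_less_iff of_nat_less_iff pos_mod_bound pos_mod_sign zero_le_imp_eq_int)
  ultimately show "e \<in> (\<Union>j<N. {i. i mod int N = int j} \<times> {k. k mod int N = int j})"
    by (cases e) auto
next
  fix e :: "int \<times> int"
  assume "e \<in> (\<Union>j<N. {i. i mod int N = int j} \<times> {k. k mod int N = int j})"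
  then have "fst e mod int N = snd e mod int N"
    by auto
  then show "e \<in> {(i, k). int N dvd i - k}"
    by (simp add: mod_eq_dvd_iff case_prod_beta)
qed

text \<open>The condition \<open>N dvd i - k\<close> says that \<open>i\<close> and \<open>k\<close> have the same residue; on a single residue class
the double sum is a product of two sums.\<close>

lemma has_sum_product_by_residue_class:
  fixes \<alpha> \<beta> :: "int \<Rightarrow> complex"
  assumes "N > 0"
    and "\<And>j. j < N \<Longrightarrow> (\<alpha> has_sum P j) {i. i mod int N = int j}"
    and "\<And>j. j < N \<Longrightarrow> (\<beta> has_sum Q j) {k. k mod int N = int j}"
  shows "((\<lambda>(i, k). \<alpha> i * \<beta> k) has_sum (\<Sum>j<N. P j * Q j)) {(i, k). int N dvd i - k}"
  unfolding residue_class_pairs[OF assms(1)]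
  using assms by (intro sum_has_sum has_sum_mult_Times) auto

section \<open>Power series of matrices\<close>

lemma pow_mat_add:
  assumes A: "A \<in> carrier_mat n n"
  shows "A ^\<^sub>m (i + j) = A ^\<^sub>m i * A ^\<^sub>m j"
proof (induction j)
  case 0
  then show ?case
    using A by (simp add: right_mult_one_mat[of _ n n])
next
  case (Suc j)
  then show ?case
    using A by (simp add: assoc_mult_mat[of _ n n _ n _ n])
qed

lemma pow_mat_smult:
  fixes c :: complex
  assumes A: "A \<in> carrier_mat n n"
  shows "(c \<cdot>\<^sub>m A) ^\<^sub>m k = c ^ k \<cdot>\<^sub>m A ^\<^sub>m k"
proof (induction k)
  case 0
  then show ?case
    using A by (intro eq_matI) auto
next
  case (Suc k)
  have "(c ^ k \<cdot>\<^sub>m A ^\<^sub>m k) * (c \<cdot>\<^sub>m A) = (c ^ k * c) \<cdot>\<^sub>m (A ^\<^sub>m k * A)"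
    using A pow_carrier_mat[OF A, of k] by (intro eq_matI) auto
  with Suc show ?case
    by (simp add: mult.commute)
qed

lemma pow_mat_transpose:
  fixes A :: "complex mat"
  assumes A: "A \<in> carrier_mat n n"
  shows "transpose_mat A ^\<^sub>m k = transpose_mat (A ^\<^sub>m k)"
proof (induction k)
  case 0
  then show ?case
    using A by simp
next
  case (Suc k)
  have "transpose_mat (A ^\<^sub>m Suc k) = transpose_mat (A ^\<^sub>m (1 + k))"
    by simp
  also have "\<dots> = transpose_mat (A * A ^\<^sub>m k)"
    using A by (subst pow_mat_add[OF A]) simp
  also have "\<dots> = transpose_mat (A ^\<^sub>m k) * transpose_mat A"
    using A pow_carrier_mat[OF A] by (rule transpose_mult)
  finally show ?case
    using Suc by simp
qed

lemma mat_vec_entry: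
  assumes "A \<in> carrier_mat nr n" "g \<in> carrier_vec n" "r < nr"
  shows "(A *\<^sub>v g) $ r = (\<Sum>k<n. A $$ (r, k) * g $ k)"
  using assms by (simp add: scalar_prod_def lessThan_atLeast0)

lemma mat_mat_entry:
  assumes "A \<in> carrier_mat nr n" "B \<in> carrier_mat n nc" "r < nr" "c < nc"
  shows "(A * B) $$ (r, c) = (\<Sum>k<n. A $$ (r, k) * B $$ (k, c))"
  using assms by (simp add: scalar_prod_def lessThan_atLeast0)

text \<open>Entrywise absolute summability of the powers is the form in which a spectral radius below one enters
the series below; it passes to the transposed matrix without a detour through eigenvalues.\<close>

definition power_summable :: "nat \<Rightarrow> complex mat \<Rightarrow> bool" where
  "power_summable n A \<longleftrightarrow> A \<in> carrier_mat n n \<and>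
     (\<forall>i<n. \<forall>k<n. (\<lambda>s. (A ^\<^sub>m s) $$ (i, k)) abs_summable_on UNIV)"

lemma power_summable_carrier: "power_summable n A \<Longrightarrow> A \<in> carrier_mat n n"
  by (simp add: power_summable_def)

lemma power_summable_transpose:
  assumes "power_summable n A"
  shows "power_summable n (transpose_mat A)"
proof -
  note A = power_summable_carrier[OF assms]
  have "(transpose_mat A ^\<^sub>m s) $$ (i, k) = (A ^\<^sub>m s) $$ (k, i)" if "i < n" "k < n" for s i k
    using that A by (simp add: pow_mat_transpose[OF A])
  with assms A show ?thesis
    by (simp add: power_summable_def)
qed

text \<open>A number \<open>r\<close> strictly between the spectral radius and \<open>1\<close> turns a mere bound into geometric decay:
\<open>A / r\<close> still has spectral radius below \<open>1\<close>, so its powers are bounded by some \<open>c\<close>, and the entries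
of \<open>A ^ s\<close> are at most \<open>c * r ^ s\<close>.\<close>

lemma spectral_radius_less_1_power_summable:
  assumes A: "A \<in> carrier_mat n n" and n: "0 < n" and \<rho>: "spectral_radius A < 1"
  shows "power_summable n A"
proof -
  define r where "r = (1 + max 0 (spectral_radius A)) / 2"
  have r: "0 < r" "r < 1" "spectral_radius A < r"
    using \<rho> by (auto simp: r_def max_def)
  let ?B = "complex_of_real (1 / r) \<cdot>\<^sub>m A"
  have B: "?B \<in> carrier_mat n n"
    using A by simp
  obtain k where k: "k \<in> spectrum ?B" "spectral_radius ?B = cmod k"
    using spectral_radius_mem_max(1)[OF B n] by auto
  then obtain v where v: "v \<in> carrier_vec n" "v \<noteq> 0\<^sub>v n" "?B *\<^sub>v v = k \<cdot>\<^sub>v v"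
    using A by (auto simp: spectrum_def eigenvalue_def eigenvector_def)
  have "A *\<^sub>v v = (complex_of_real r * k) \<cdot>\<^sub>v v"
  proof (rule eq_vecI)
    fix i assume "i < dim_vec ((complex_of_real r * k) \<cdot>\<^sub>v v)"
    then have i: "i < n"
      using v(1) by simp
    have "(?B *\<^sub>v v) $ i = k * v $ i"
      using v i by simp
    also have "(?B *\<^sub>v v) $ i = complex_of_real (1 / r) * (A *\<^sub>v v) $ i"
      using A v(1) i by simp
    finally show "(A *\<^sub>v v) $ i = ((complex_of_real r * k) \<cdot>\<^sub>v v) $ i"
      using v i r(1) by (simp add: field_simps)
  qed (use A v in auto)
  then have "complex_of_real r * k \<in> spectrum A"
    using A v by (auto simp: spectrum_def eigenvalue_def eigenvector_def)
  then have "cmod (complex_of_real r * k) \<le> spectral_radius A"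
    using spectral_radius_mem_max(2)[OF A n] by blast
  then have "r * cmod k \<le> spectral_radius A"
    using r(1) by (simp add: norm_mult)
  then have "r * cmod k < r * 1"
    using r(3) by linarith
  then have "spectral_radius ?B < 1"
    using k(2) r(1) by (simp only: mult_less_cancel_left_pos)
  then obtain c where c: "\<And>s. norm_bound (?B ^\<^sub>m s) c"
    using spectral_radius_jnf_norm_bound_less_1_upper_triangular[OF B] by blast
  have bound: "cmod ((A ^\<^sub>m s) $$ (i, k)) \<le> c * r ^ s" if ik: "i < n" "k < n" for s i k
  proof -
    have "cmod ((?B ^\<^sub>m s) $$ (i, k)) \<le> c"
      using c[of s] B ik pow_carrier_mat[OF B, of s] unfolding norm_bound_def
      by (metis carrier_matD)
    moreover have "(?B ^\<^sub>m s) $$ (i, k) = complex_of_real (1 / r) ^ s * (A ^\<^sub>m s) $$ (i, k)"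
      using ik A by (simp add: pow_mat_smult[OF A])
    moreover have "cmod (complex_of_real (1 / r) ^ s * (A ^\<^sub>m s) $$ (i, k))
        = cmod ((A ^\<^sub>m s) $$ (i, k)) / r ^ s"
      using r(1) by (simp add: norm_mult norm_power norm_divide power_one_over)
    ultimately show ?thesis
      using r(1) by (simp add: pos_divide_le_eq)
  qed
  have geom: "(\<lambda>s. c * r ^ s) summable_on UNIV"
    using r(1,2) by (intro summable_on_cmult_right norm_summable_imp_summable_on) (simp add: summable_geometric)
  have "(\<lambda>s. (A ^\<^sub>m s) $$ (i, k)) abs_summable_on UNIV" if "i < n" "k < n" for i k
    using bound[OF that] by (intro abs_summable_on_comparison_test'[OF geom]) simp
  with A show ?thesis
    by (simp add: power_summable_def)
qed

lemma has_sum_finite_sum: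
  fixes f :: "'k \<Rightarrow> 'e \<Rightarrow> complex"
  assumes "finite K" and "\<And>k. k \<in> K \<Longrightarrow> (f k has_sum s k) A"
  shows "((\<lambda>e. \<Sum>k\<in>K. f k e) has_sum (\<Sum>k\<in>K. s k)) A"
  using assms by (induction) (auto intro: has_sum_add)

lemma has_sum_mat_vec:
  fixes c :: "'e \<Rightarrow> complex"
  assumes M: "M \<in> carrier_mat nr n" and F: "\<And>e. e \<in> A \<Longrightarrow> F e \<in> carrier_vec n"
    and s: "s \<in> carrier_vec n" and r: "r < nr"
    and sum: "\<And>k. k < n \<Longrightarrow> ((\<lambda>e. c e * F e $ k) has_sum s $ k) A"
  shows "((\<lambda>e. c e * (M *\<^sub>v F e) $ r) has_sum (M *\<^sub>v s) $ r) A"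
proof -
  have "((\<lambda>e. \<Sum>k<n. M $$ (r, k) * (c e * F e $ k)) has_sum (\<Sum>k<n. M $$ (r, k) * s $ k)) A"
    using sum by (intro has_sum_finite_sum has_sum_cmult_right) auto
  also have "(\<Sum>k<n. M $$ (r, k) * s $ k) = (M *\<^sub>v s) $ r"
    using mat_vec_entry[OF M s r] by simp
  also have "((\<lambda>e. \<Sum>k<n. M $$ (r, k) * (c e * F e $ k)) has_sum (M *\<^sub>v s) $ r) A
      \<longleftrightarrow> ?thesis"
    by (intro has_sum_cong) (simp add: mat_vec_entry[OF M F r] sum_distrib_left mult.left_commute)
  finally show ?thesis .
qed

lemma has_sum_mat_entries_vec:
  fixes c :: "'e \<Rightarrow> complex"
  assumes M: "\<And>e. e \<in> A \<Longrightarrow> M e \<in> carrier_mat nr n" and T: "T \<in> carrier_mat nr n"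
    and g: "g \<in> carrier_vec n" and r: "r < nr"
    and sum: "\<And>k. k < n \<Longrightarrow> ((\<lambda>e. c e * M e $$ (r, k)) has_sum T $$ (r, k)) A"
  shows "((\<lambda>e. c e * (M e *\<^sub>v g) $ r) has_sum (T *\<^sub>v g) $ r) A"
proof -
  have "((\<lambda>e. \<Sum>k<n. c e * M e $$ (r, k) * g $ k) has_sum (\<Sum>k<n. T $$ (r, k) * g $ k)) A"
    using sum by (intro has_sum_finite_sum has_sum_cmult_left) auto
  also have "(\<Sum>k<n. T $$ (r, k) * g $ k) = (T *\<^sub>v g) $ r"
    using mat_vec_entry[OF T g r] by simp
  also have "((\<lambda>e. \<Sum>k<n. c e * M e $$ (r, k) * g $ k) has_sum (T *\<^sub>v g) $ r) A
      \<longleftrightarrow> ?thesis"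
    by (intro has_sum_cong) (simp add: mat_vec_entry[OF M g r] sum_distrib_left mult.assoc)
  finally show ?thesis .
qed

lemma mat_infsum_carrier: "mat_infsum n F S \<in> carrier_mat n n"
  by (simp add: mat_infsum_def)

lemma power_summable_weighted:
  assumes A: "power_summable n A" and c: "\<And>s. cmod (c s) = 1" and ik: "i < n" "k < n"
  shows "(\<lambda>s. c s * (A ^\<^sub>m (s + d)) $$ (i, k)) summable_on S"
proof -
  have "(\<lambda>s. cmod ((A ^\<^sub>m s) $$ (i, k))) summable_on (\<lambda>s. s + d) ` S"
    using A ik summable_on_subset unfolding power_summable_def by blast
  then have "(\<lambda>s. cmod ((A ^\<^sub>m (s + d)) $$ (i, k))) summable_on S"
    by (subst (asm) summable_on_reindex) (auto simp: o_def inj_on_def)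
  then have "(\<lambda>s. c s * (A ^\<^sub>m (s + d)) $$ (i, k)) abs_summable_on S"
    by (simp add: norm_mult c)
  then show ?thesis
    using summable_on_iff_abs_summable_on_complex by blast
qed

lemma has_sum_power_vec:
  assumes A: "power_summable n A" and c: "\<And>s. cmod (c s) = 1"
    and g: "g \<in> carrier_vec n" and r: "r < n"
  shows "((\<lambda>s. c s * (A ^\<^sub>m (s + d) *\<^sub>v g) $ r)
      has_sum (mat_infsum n (\<lambda>s. c s \<cdot>\<^sub>m A ^\<^sub>m (s + d)) S *\<^sub>v g) $ r) S"
proof (rule has_sum_mat_entries_vec[OF _ _ g r])
  note Ac = power_summable_carrier[OF A]
  show "A ^\<^sub>m (s + d) \<in> carrier_mat n n" for s
    using Ac by (rule pow_carrier_mat)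
  show "mat_infsum n (\<lambda>s. c s \<cdot>\<^sub>m A ^\<^sub>m (s + d)) S \<in> carrier_mat n n"
    by (rule mat_infsum_carrier)
  fix k assume k: "k < n"
  have "infsum (\<lambda>s. (c s \<cdot>\<^sub>m A ^\<^sub>m (s + d)) $$ (r, k)) S
      = infsum (\<lambda>s. c s * (A ^\<^sub>m (s + d)) $$ (r, k)) S"
    using Ac r k by (intro infsum_cong) (simp add: pow_mat_dim_square[OF Ac])
  then show "((\<lambda>s. c s * (A ^\<^sub>m (s + d)) $$ (r, k))
      has_sum mat_infsum n (\<lambda>s. c s \<cdot>\<^sub>m A ^\<^sub>m (s + d)) S $$ (r, k)) S"
    using power_summable_weighted[OF A c r k] r k by (simp add: mat_infsum_def)
qed

section \<open>Two-sided powers by residue class\<close>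

text \<open>The shape of the Laurent coefficients of the inverse of a matrix Laurent polynomial, up to a constant
factor: powers of \<open>Y\<close> at non-negative and powers of \<open>X\<close> at negative exponents.\<close>

definition two_sided_power :: "complex mat \<Rightarrow> complex mat \<Rightarrow> int \<Rightarrow> complex mat" where
  "two_sided_power X Y i = (if 0 \<le> i then Y ^\<^sub>m nat i else X ^\<^sub>m nat (- i))"

lemma two_sided_power_carrier:
  "X \<in> carrier_mat n n \<Longrightarrow> Y \<in> carrier_mat n n \<Longrightarrow> two_sided_power X Y i \<in> carrier_mat n n"
  by (simp add: two_sided_power_def)

lemma two_sided_power_int:
  "two_sided_power X Y (int k) = Y ^\<^sub>m k"
  "X \<in> carrier_mat n n \<Longrightarrow> Y \<in> carrier_mat n n \<Longrightarrow> two_sided_power X Y (- int k) = X ^\<^sub>m k"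
  by (auto simp: two_sided_power_def)

text \<open>With \<open>N = 2 ^ h\<close> this is where the Krylov columns come from. A non-negative \<open>i\<close> in the residue class of
\<open>j\<close> is \<open>j + s\<close> with \<open>N dvd s\<close>, which gives the Krylov column with number \<open>j\<close> of \<open>Y\<close>. A negative one is
\<open>- (N - 1 - j) - (s + 1)\<close> with \<open>N dvd s\<close>, which gives the column with number \<open>N - 1 - j\<close> of \<open>X\<close>: this
reflection is the origin of the counter-identity matrix.\<close>

lemma has_sum_two_sided_power_residue_class:
  assumes X: "power_summable n X" and Y: "power_summable n Y" and g: "g \<in> carrier_vec n"
    and z: "cmod z = 1" and r: "r < n" and j: "j < N"
  shows "((\<lambda>i. z powi i * (two_sided_power X Y i *\<^sub>v g) $ r) has_sum
      z ^ j * (Y ^\<^sub>m j *\<^sub>v (mat_infsum n (\<lambda>s. z ^ s \<cdot>\<^sub>m Y ^\<^sub>m s) {s. N dvd s} *\<^sub>v g)) $ r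
      + z powi (- int (N - 1 - j)) * (X ^\<^sub>m (N - 1 - j) *\<^sub>v
          (mat_infsum n (\<lambda>s. z powi (- int s - 1) \<cdot>\<^sub>m X ^\<^sub>m (s + 1)) {s. N dvd s} *\<^sub>v g)) $ r)
      {i. i mod int N = int j}"
proof -
  let ?S = "{s. N dvd s}" and ?l = "N - 1 - j"
  let ?y = "mat_infsum n (\<lambda>s. z ^ s \<cdot>\<^sub>m Y ^\<^sub>m s) ?S *\<^sub>v g"
  let ?x = "mat_infsum n (\<lambda>s. z powi (- int s - 1) \<cdot>\<^sub>m X ^\<^sub>m (s + 1)) ?S *\<^sub>v g"
  let ?f = "\<lambda>i. z powi i * (two_sided_power X Y i *\<^sub>v g) $ r"
  note Xc = power_summable_carrier[OF X] and Yc = power_summable_carrier[OF Y]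
  have zpow: "cmod (z powi i) = 1" for i
    using z by (simp add: norm_power_int)
  have "((\<lambda>s. z ^ s * (Y ^\<^sub>m j *\<^sub>v (Y ^\<^sub>m (s + 0) *\<^sub>v g)) $ r) has_sum (Y ^\<^sub>m j *\<^sub>v ?y) $ r) ?S"
    by (rule has_sum_mat_vec[OF pow_carrier_mat[OF Yc] mult_mat_vec_carrier[OF pow_carrier_mat[OF Yc] g]
          mult_mat_vec_carrier[OF mat_infsum_carrier g] r])
      (use has_sum_power_vec[OF Y _ g, of "\<lambda>s. z ^ s" _ 0 ?S] z in \<open>simp add: norm_power\<close>)
  then have "((\<lambda>s. z ^ j * (z ^ s * (Y ^\<^sub>m j *\<^sub>v (Y ^\<^sub>m s *\<^sub>v g)) $ r))
      has_sum z ^ j * (Y ^\<^sub>m j *\<^sub>v ?y) $ r) ?S"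
    using has_sum_cmult_right by fastforce
  also have "?this \<longleftrightarrow> (?f has_sum z ^ j * (Y ^\<^sub>m j *\<^sub>v ?y) $ r) {i. i mod int N = int j \<and> 0 \<le> i}"
  proof (rule has_sum_reindex_bij_witness[where j = "\<lambda>s. int (j + s)" and i = "\<lambda>i. nat i - j"])
    fix s assume "s \<in> ?S"
    then show "int (j + s) \<in> {i. i mod int N = int j \<and> 0 \<le> i}"
      using j by (auto elim!: dvdE)
    show "?f (int (j + s)) = z ^ j * (z ^ s * (Y ^\<^sub>m j *\<^sub>v (Y ^\<^sub>m s *\<^sub>v g)) $ r)"
      using g by (simp add: two_sided_power_int(1) pow_mat_add[OF Yc] power_add
          assoc_mult_mat_vec[OF pow_carrier_mat[OF Yc] pow_carrier_mat[OF Yc]] del: of_nat_add)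
  next
    fix i assume i: "i \<in> {i. i mod int N = int j \<and> 0 \<le> i}"
    then have "i = int N * (i div int N) + int j"
      by (metis (mono_tags, lifting) mem_Collect_eq mult_div_mod_eq)
    moreover have "0 \<le> i div int N"
      using i j by (simp add: pos_imp_zdiv_nonneg_iff)
    ultimately obtain q where q: "i = int (N * q + j)"
      by (metis nonneg_int_cases of_nat_add of_nat_mult)
    then have "nat i = N * q + j"
      by (simp only: nat_int)
    then show "int (j + (nat i - j)) = i" "nat i - j \<in> ?S"
      using q by simp_all
  qed auto
  finally have nonneg: "(?f has_sum z ^ j * (Y ^\<^sub>m j *\<^sub>v ?y) $ r) {i. i mod int N = int j \<and> 0 \<le> i}" .
  have "((\<lambda>s. z powi (- int s - 1) * (X ^\<^sub>m ?l *\<^sub>v (X ^\<^sub>m (s + 1) *\<^sub>v g)) $ r)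
      has_sum (X ^\<^sub>m ?l *\<^sub>v ?x) $ r) ?S"
    by (rule has_sum_mat_vec[OF pow_carrier_mat[OF Xc] mult_mat_vec_carrier[OF pow_carrier_mat[OF Xc] g]
          mult_mat_vec_carrier[OF mat_infsum_carrier g] r])
      (rule has_sum_power_vec[OF X zpow g])
  then have "((\<lambda>s. z powi (- int ?l) * (z powi (- int s - 1) * (X ^\<^sub>m ?l *\<^sub>v (X ^\<^sub>m (s + 1) *\<^sub>v g)) $ r))
      has_sum z powi (- int ?l) * (X ^\<^sub>m ?l *\<^sub>v ?x) $ r) ?S"
    by (rule has_sum_cmult_right)
  also have "?this \<longleftrightarrow> (?f has_sum z powi (- int ?l) * (X ^\<^sub>m ?l *\<^sub>v ?x) $ r)
      {i. i mod int N = int j \<and> i < 0}"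
  proof (rule has_sum_reindex_bij_witness[where j = "\<lambda>s. - int (?l + (s + 1))"
        and i = "\<lambda>i. nat (- i) - 1 - ?l"])
    fix s assume "s \<in> ?S"
    then obtain q where q: "s = N * q"
      by auto
    have "- int (?l + (s + 1)) = int j + int N * (- int q - 1)"
      using j q by (simp add: algebra_simps of_nat_diff)
    then have "- int (?l + (s + 1)) mod int N = int j"
      using j by (simp only: mod_mult_self2 zmod_int[symmetric] mod_less)
    then show "- int (?l + (s + 1)) \<in> {i. i mod int N = int j \<and> i < 0}"
      by simp
    have split: "- int (?l + (s + 1)) = - int ?l + (- int s - 1)"
      by simp
    have "z powi (- int (?l + (s + 1))) = z powi (- int ?l) * z powi (- int s - 1)"
      unfolding split using z by (intro power_int_add) auto
    moreover have "two_sided_power X Y (- int (?l + (s + 1))) = X ^\<^sub>m (?l + (s + 1))"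
      by (rule two_sided_power_int(2)[OF Xc Yc])
    ultimately show "?f (- int (?l + (s + 1)))
        = z powi (- int ?l) * (z powi (- int s - 1) * (X ^\<^sub>m ?l *\<^sub>v (X ^\<^sub>m (s + 1) *\<^sub>v g)) $ r)"
      using Xc g by (simp only: pow_mat_add[OF Xc, of ?l] mult.assoc
          assoc_mult_mat_vec[OF pow_carrier_mat[OF Xc] pow_carrier_mat[OF Xc] g])
  next
    fix i assume i: "i \<in> {i. i mod int N = int j \<and> i < 0}"
    then have "i = int N * (i div int N) + int j"
      by (metis (mono_tags, lifting) mem_Collect_eq mult_div_mod_eq)
    moreover have "i div int N < 0"
      using i j by (simp add: div_neg_pos_less0)
    then have "i div int N = - int (nat (- (i div int N) - 1)) - 1"
      by simp
    then obtain q where "i div int N = - int q - 1" ..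
    ultimately have q: "- i = int (N * q + 1 + ?l)"
      using j by (simp add: algebra_simps of_nat_diff)
    then have "nat (- i) = N * q + 1 + ?l"
      by (simp only: nat_int)
    then show "- int (?l + (nat (- i) - 1 - ?l + 1)) = i" "nat (- i) - 1 - ?l \<in> ?S"
      using q by simp_all
  qed auto
  finally have neg: "(?f has_sum z powi (- int ?l) * (X ^\<^sub>m ?l *\<^sub>v ?x) $ r)
      {i. i mod int N = int j \<and> i < 0}" .
  have residue_class: "{i. i mod int N = int j} = {i. i mod int N = int j \<and> 0 \<le> i} \<union> {i. i mod int N = int j \<and> i < 0}"
    by auto
  show ?thesis
    unfolding residue_class by (rule has_sum_Un_disjoint[OF nonneg neg]) auto
qed

section \<open>Invertibility of matrix Laurent polynomials\<close>

lemma minv_unique: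
  assumes M: "M \<in> carrier_mat n n" and N: "N \<in> carrier_mat n n" and MN: "M * N = 1\<^sub>m n"
  shows "minv M = N" "det M \<noteq> 0"
proof -
  have "det M * det N = 1"
    using det_mult[OF M N] MN by simp
  then show d: "det M \<noteq> 0"
    by auto
  have "mat_inverse M \<noteq> None"
    using mat_inverse(1)[OF M, where b = "()"] det_non_zero_imp_unit[OF M d, where b = "()"] by blast
  then obtain B where B: "mat_inverse M = Some B"
    by blast
  then have BM: "B * M = 1\<^sub>m n" "B \<in> carrier_mat n n"
    using mat_inverse(2)[OF M] by blast+
  have "B = B * (M * N)"
    using BM(2) by (simp add: MN)
  also have "\<dots> = N"
    using assoc_mult_mat[OF BM(2) M N, symmetric] BM(1) N by simp
  finally show "minv M = N"
    by (simp add: minv_def B)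
qed

lemma minv_inverse:
  assumes M: "M \<in> carrier_mat n n" and d: "det M \<noteq> 0"
  shows "minv M \<in> carrier_mat n n" "M * minv M = 1\<^sub>m n" "minv M * M = 1\<^sub>m n"
proof -
  have "mat_inverse M \<noteq> None"
    using mat_inverse(1)[OF M, where b = "()"] det_non_zero_imp_unit[OF M d, where b = "()"] by blast
  then obtain B where B: "mat_inverse M = Some B"
    by blast
  then show "minv M \<in> carrier_mat n n" "M * minv M = 1\<^sub>m n" "minv M * M = 1\<^sub>m n"
    using mat_inverse(2)[OF M B] by (simp_all add: minv_def)
qed

lemma minv_transpose:
  assumes M: "M \<in> carrier_mat n n" and d: "det M \<noteq> 0"
  shows "minv (transpose_mat M) = transpose_mat (minv M)"
proof (rule minv_unique(1))
  note I = minv_inverse[OF M d]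
  show "transpose_mat M * transpose_mat (minv M) = 1\<^sub>m n"
    using transpose_mult[OF I(1) M] I(3) by simp
qed (use M minv_inverse(1)[OF M d] in auto)

lemma invertible_mat_det:
  fixes M :: "complex mat"
  assumes M: "M \<in> carrier_mat n n" and inv: "invertible_mat M"
  shows "det M \<noteq> 0"
proof -
  obtain B where B: "M * B = 1\<^sub>m n" "B * M = 1\<^sub>m (dim_row B)"
    using inv M by (auto simp: invertible_mat_def inverts_mat_def)
  have "dim_col (M * B) = n" "dim_col (B * M) = dim_row B"
    using B by simp_all
  then have "B \<in> carrier_mat n n"
    using M by auto
  then show ?thesis
    using minv_unique(2)[OF M _ B(1)] by simp
qed

lemma laurent_eval_carrier:
  assumes "Bm \<in> carrier_mat n n" "B0 \<in> carrier_mat n n" "B1 \<in> carrier_mat n n"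
  shows "laurent_eval Bm B0 B1 x \<in> carrier_mat n n"
  using assms by (simp add: laurent_eval_def)

lemma laurent_eval_entry:
  assumes "Bm \<in> carrier_mat n n" "B0 \<in> carrier_mat n n" "B1 \<in> carrier_mat n n" "i < n" "k < n"
  shows "laurent_eval Bm B0 B1 x $$ (i, k)
    = inverse x * Bm $$ (i, k) + B0 $$ (i, k) + x * B1 $$ (i, k)"
  using assms by (simp add: laurent_eval_def)

lemma poly_pencil_det:
  assumes B: "Bm \<in> carrier_mat n n" "B0 \<in> carrier_mat n n" "B1 \<in> carrier_mat n n" and x: "x \<noteq> 0"
  shows "poly (pencil_det n Bm B0 B1) x = x ^ n * det (laurent_eval Bm B0 B1 x)"
proof -
  let ?M = "mat n n (\<lambda>(i, j). [:Bm $$ (i, j), B0 $$ (i, j), B1 $$ (i, j):])"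
  have "poly (pencil_det n Bm B0 B1) x = det (map_mat (\<lambda>q. poly q x) ?M)"
    unfolding pencil_det_def by (rule comm_ring_hom.hom_det[OF poly_hom.comm_ring_hom_axioms, symmetric])
  also have "map_mat (\<lambda>q. poly q x) ?M = x \<cdot>\<^sub>m laurent_eval Bm B0 B1 x"
    using B x by (intro eq_matI) (auto simp: laurent_eval_def field_simps)
  finally show ?thesis
    using laurent_eval_carrier[OF B, of x] by simp
qed

text \<open>A zero of the determinant on the unit circle would be one of the eigenvalues, but the splitting keeps
all eigenvalues off the circle.\<close>

lemma splitting_det_nonzero:
  assumes B: "Bm \<in> carrier_mat n n" "B0 \<in> carrier_mat n n" "B1 \<in> carrier_mat n n" and n: "0 < n"
    and split: "splitting n t Bm B0 B1" and x: "cmod x = 1"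
  shows "det (laurent_eval Bm B0 B1 x) \<noteq> 0"
proof
  assume "det (laurent_eval Bm B0 B1 x) = 0"
  with x have root: "poly (pencil_det n Bm B0 B1) x = 0"
    by (subst poly_pencil_det[OF B]) auto
  let ?d = "pencil_det n Bm B0 B1"
  from split obtain \<xi> where t: "0 < t" "t < 1" and d: "?d \<noteq> 0"
    and \<xi>: "mset \<xi> = laurent_eigenvalues n Bm B0 B1" "sorted (map emod \<xi>)"
    "\<forall>i < n. emod (\<xi> ! i) < ereal t" "\<forall>i \<in> {n..<2 * n}. ereal (1 / t) < emod (\<xi> ! i)"
    unfolding splitting_def by blast
  have "x \<in># proots ?d"
    using root d by simp
  then have "Some x \<in># mset \<xi>"
    by (simp add: \<xi>(1) laurent_eigenvalues_def Let_def)
  then obtain i where i: "i < length \<xi>" "\<xi> ! i = Some x"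
    by (metis in_set_conv_nth set_mset_mset)
  show False
  proof (cases "i < n")
    case True
    then have "ereal 1 < ereal t"
      using \<xi>(3) i(2) x by fastforce
    with t show False
      by simp
  next
    case False
    \<comment> \<open>sortedness transfers the lower bound from position \<open>n\<close> to every later one\<close>
    have "ereal (1 / t) < emod (\<xi> ! n)"
      using \<xi>(4) n by simp
    also have "\<dots> \<le> emod (\<xi> ! i)"
      using sorted_nth_mono[OF \<xi>(2), of n i] False i(1) by simp
    finally show False
      using t i(2) x by simp
  qed
qed

section \<open>Laurent expansion of the inverse from solvents\<close>

text \<open>Let \<open>S g x\<close> be the two-sided power series applied to the vector \<open>g\<close>. By the equations for \<open>X\<close> and \<open>Y\<close>
the Laurent polynomial maps it to \<open>Q *\<^sub>v g\<close>, which does not depend on \<open>x\<close>. The matrix \<open>Q\<close> is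
injective: if \<open>Q *\<^sub>v g = 0\<close>, then \<open>S g x = 0\<close> on the whole circle because the Laurent polynomial is
invertible there, and the constant coefficient of \<open>S g\<close> is \<open>g\<close> itself. Hence the inverse applied to \<open>w\<close> is
\<open>S g\<close> with \<open>g\<close> the solution of \<open>Q *\<^sub>v g = w\<close>, and a second comparison of constant coefficients
identifies \<open>g\<close> with \<open>H 0 *\<^sub>v w\<close>.\<close>

lemma inverse_two_sided_power_expansion:
  assumes B: "Bm \<in> carrier_mat n n" "B0 \<in> carrier_mat n n" "B1 \<in> carrier_mat n n"
    and X: "power_summable n X" "B1 * (X * X) + B0 * X + Bm = 0\<^sub>m n n"
    and Y: "power_summable n Y" "B1 + B0 * Y + Bm * (Y * Y) = 0\<^sub>m n n"
    and inv: "\<And>x. cmod x = 1 \<Longrightarrow> det (laurent_eval Bm B0 B1 x) \<noteq> 0"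
    and H: "\<And>j. H j \<in> carrier_mat n n"
    and exp: "\<And>x i k. cmod x = 1 \<Longrightarrow> i < n \<Longrightarrow> k < n \<Longrightarrow>
      ((\<lambda>j. x powi j * H j $$ (i, k)) has_sum minv (laurent_eval Bm B0 B1 x) $$ (i, k)) UNIV"
    and w: "w \<in> carrier_vec n" and x: "cmod x = 1" and r: "r < n"
  shows "((\<lambda>i. x powi i * (two_sided_power X Y i *\<^sub>v (H 0 *\<^sub>v w)) $ r)
      has_sum (minv (laurent_eval Bm B0 B1 x) *\<^sub>v w) $ r) UNIV"
proof -
  note Xc = power_summable_carrier[OF X(1)] and Yc = power_summable_carrier[OF Y(1)]
  note Pc = two_sided_power_carrier[OF Xc Yc]
  let ?P = "two_sided_power X Y" and ?L = "laurent_eval Bm B0 B1"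
  define Q where "Q = Bm * Y + B0 + B1 * X"
  have Qc: "Q \<in> carrier_mat n n"
    using B Xc Yc by (simp add: Q_def)
  note Lc = laurent_eval_carrier[OF B]
  note Li = minv_inverse[OF Lc inv]
  have Fc: "?P i *\<^sub>v g \<in> carrier_vec n" if "g \<in> carrier_vec n" for i g
    using mult_mat_vec_carrier[OF Pc that] .
  define S where "S g x = vec n (\<lambda>r. \<Sum>\<^sub>\<infinity>i. x powi i * (?P i *\<^sub>v g) $ r)" for g x
  have Sc: "S g x \<in> carrier_vec n" for g x
    by (simp add: S_def)
  have S: "((\<lambda>i. x powi i * (?P i *\<^sub>v g) $ r) has_sum S g x $ r) UNIV"
    if g: "g \<in> carrier_vec n" and x: "cmod x = 1" and r: "r < n" for g x r
  proof -
    have "{i. i mod int 1 = int 0} = UNIV"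
      by auto
    then have "(\<lambda>i. x powi i * (?P i *\<^sub>v g) $ r) summable_on UNIV"
      using has_sum_imp_summable[OF has_sum_two_sided_power_residue_class[OF X(1) Y(1) g x r, of 0 1]]
      by simp
    then show ?thesis
      using r by (simp add: S_def)
  qed
  have recurrence: "(Bm *\<^sub>v (?P (i + 1) *\<^sub>v g)) $ r + (B0 *\<^sub>v (?P i *\<^sub>v g)) $ r
      + (B1 *\<^sub>v (?P (i - 1) *\<^sub>v g)) $ r = (if i = 0 then (Q *\<^sub>v g) $ r else 0)"
    if g: "g \<in> carrier_vec n" and r: "r < n" for i g r
  proof -
    have MPg: "(M *\<^sub>v (?P k *\<^sub>v g)) = (M * ?P k) *\<^sub>v g" if "M \<in> carrier_mat n n" for M k
      using assoc_mult_mat_vec[OF that Pc g] by simp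
    have "(Bm *\<^sub>v (?P (i + 1) *\<^sub>v g)) $ r + (B0 *\<^sub>v (?P i *\<^sub>v g)) $ r
        + (B1 *\<^sub>v (?P (i - 1) *\<^sub>v g)) $ r
        = ((Bm * ?P (i + 1) + B0 * ?P i + B1 * ?P (i - 1)) *\<^sub>v g) $ r"
      using B Pc g r
      by (simp add: MPg add_mult_distrib_mat_vec[of _ n n] del: index_mult_mat_vec assoc_mult_mat_vec)
    also have "Bm * ?P (i + 1) + B0 * ?P i + B1 * ?P (i - 1) = (if i = 0 then Q else 0\<^sub>m n n)"
    proof (cases i "0 :: int" rule: linorder_cases)
      case equal
      then show ?thesis
        using B Xc Yc by (simp add: two_sided_power_def Q_def)
    next
      case greater
      then obtain k where i: "i = int (1 + k)"
        by (metis zero_less_imp_eq_int Suc_pred plus_1_eq_Suc)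
      note Yk = pow_carrier_mat[OF Yc, of k]
      have P: "?P (i + 1) = Y * Y * Y ^\<^sub>m k" "?P i = Y * Y ^\<^sub>m k" "?P (i - 1) = Y ^\<^sub>m k"
        using two_sided_power_int(1)[of X Y "2 + k"] two_sided_power_int(1)[of X Y "1 + k"]
          two_sided_power_int(1)[of X Y k] Yc
        unfolding pow_mat_add[OF Yc] by (simp_all add: i numeral_2_eq_2 add_ac)
      have "(B1 + B0 * Y + Bm * (Y * Y)) * Y ^\<^sub>m k
          = B1 * Y ^\<^sub>m k + B0 * (Y * Y ^\<^sub>m k) + Bm * (Y * Y * Y ^\<^sub>m k)"
        using B Yc Yk
        by (simp add: add_mult_distrib_mat[of _ n n _ _ n] assoc_mult_mat[of _ n n _ n _ n]
            del: assoc_add_mat)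
      also have "\<dots> = Bm * ?P (i + 1) + B0 * ?P i + B1 * ?P (i - 1)"
        unfolding P using B Yc Yk by (intro eq_matI) auto
      finally show ?thesis
        using greater left_mult_zero_mat[OF Yk, of n] by (simp add: Y(2))
    next
      case less
      then obtain k where i: "i = - int (1 + k)"
        by (metis zero_less_imp_eq_int Suc_pred plus_1_eq_Suc minus_minus neg_0_less_iff_less)
      note Xk = pow_carrier_mat[OF Xc, of k]
      have P: "?P (i - 1) = X * X * X ^\<^sub>m k" "?P i = X * X ^\<^sub>m k" "?P (i + 1) = X ^\<^sub>m k"
        using two_sided_power_int(2)[OF Xc Yc, of "2 + k"] two_sided_power_int(2)[OF Xc Yc, of "1 + k"]
          two_sided_power_int(2)[OF Xc Yc, of k] Xc
        unfolding pow_mat_add[OF Xc] by (simp_all add: i numeral_2_eq_2 algebra_simps)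
      have "(B1 * (X * X) + B0 * X + Bm) * X ^\<^sub>m k
          = B1 * (X * X * X ^\<^sub>m k) + B0 * (X * X ^\<^sub>m k) + Bm * X ^\<^sub>m k"
        using B Xc Xk
        by (simp add: add_mult_distrib_mat[of _ n n _ _ n] assoc_mult_mat[of _ n n _ n _ n]
            del: assoc_add_mat)
      also have "\<dots> = Bm * ?P (i + 1) + B0 * ?P i + B1 * ?P (i - 1)"
        unfolding P using B Xc Xk by (intro eq_matI) auto
      finally show ?thesis
        using less left_mult_zero_mat[OF Xk, of n] by (simp add: X(2))
    qed
    also have "((if i = 0 then Q else 0\<^sub>m n n) *\<^sub>v g) $ r = (if i = 0 then (Q *\<^sub>v g) $ r else 0)"
      using g r by simp
    finally show ?thesis .
  qed
  have LS: "?L x *\<^sub>v S g x = Q *\<^sub>v g" if g: "g \<in> carrier_vec n" and x: "cmod x = 1" for g x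
  proof (rule eq_vecI)
    fix r assume "r < dim_vec (Q *\<^sub>v g)"
    then have r: "r < n"
      using Qc by simp
    from x have x0: "x \<noteq> 0"
      by auto
    have part: "((\<lambda>i. x powi i * (M *\<^sub>v (?P i *\<^sub>v g)) $ r) has_sum (M *\<^sub>v S g x) $ r) UNIV"
      if "M \<in> carrier_mat n n" for M
      using S[OF g x] by (intro has_sum_mat_vec[OF that Fc[OF g] Sc r])
    \<comment> \<open>each outer coefficient shifts the exponents of the series by one\<close>
    have "((\<lambda>i. x powi (i - 1) * (Bm *\<^sub>v (?P i *\<^sub>v g)) $ r) has_sum inverse x * (Bm *\<^sub>v S g x) $ r) UNIV"
      using has_sum_cmult_right[OF part[OF B(1)], of "inverse x"] x0
      by (simp add: power_int_diff field_simps)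
    then have m: "((\<lambda>i. x powi i * (Bm *\<^sub>v (?P (i + 1) *\<^sub>v g)) $ r) has_sum inverse x * (Bm *\<^sub>v S g x) $ r) UNIV"
      by (subst has_sum_reindex_bij_witness[where j = "\<lambda>i. i + 1" and i = "\<lambda>i. i - 1" and T = UNIV]) auto
    have "((\<lambda>i. x powi (i + 1) * (B1 *\<^sub>v (?P i *\<^sub>v g)) $ r) has_sum x * (B1 *\<^sub>v S g x) $ r) UNIV"
      using has_sum_cmult_right[OF part[OF B(3)], of x] x0
      by (simp add: power_int_add field_simps)
    then have p: "((\<lambda>i. x powi i * (B1 *\<^sub>v (?P (i - 1) *\<^sub>v g)) $ r) has_sum x * (B1 *\<^sub>v S g x) $ r) UNIV"
      by (subst has_sum_reindex_bij_witness[where j = "\<lambda>i. i - 1" and i = "\<lambda>i. i + 1" and T = UNIV]) auto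
    have "((\<lambda>i. x powi i * (if i = 0 then (Q *\<^sub>v g) $ r else 0)) has_sum
        inverse x * (Bm *\<^sub>v S g x) $ r + (B0 *\<^sub>v S g x) $ r + x * (B1 *\<^sub>v S g x) $ r) UNIV"
      using has_sum_add[OF has_sum_add[OF m part[OF B(2)]] p]
      unfolding recurrence[OF g r, symmetric] by (simp only: distrib_left)
    moreover have "((\<lambda>i. x powi i * (if i = 0 then (Q *\<^sub>v g) $ r else 0)) has_sum (Q *\<^sub>v g) $ r) UNIV"
      by (rule has_sum_finite_neutralI[of "{0}"]) auto
    ultimately have "inverse x * (Bm *\<^sub>v S g x) $ r + (B0 *\<^sub>v S g x) $ r + x * (B1 *\<^sub>v S g x) $ r
        = (Q *\<^sub>v g) $ r"
      by (rule has_sum_unique)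
    moreover have "(?L x *\<^sub>v S g x) $ r
        = inverse x * (Bm *\<^sub>v S g x) $ r + (B0 *\<^sub>v S g x) $ r + x * (B1 *\<^sub>v S g x) $ r"
      using B r
      by (simp add: mat_vec_entry[OF _ Sc r] Lc laurent_eval_entry[OF B r] sum_distrib_left sum.distrib
          algebra_simps del: index_mult_mat_vec)
    ultimately show "(?L x *\<^sub>v S g x) $ r = (Q *\<^sub>v g) $ r"
      by simp
  qed (use Lc Qc in auto)
  have coeff0_unique: "g = g'"
    if g: "g \<in> carrier_vec n" "g' \<in> carrier_vec n"
      and a: "\<And>x r. cmod x = 1 \<Longrightarrow> r < n \<Longrightarrow> ((\<lambda>j. x powi j * a j r) has_sum S g x $ r) UNIV"
      and a0: "\<And>r. r < n \<Longrightarrow> a 0 r = g' $ r" for g g' a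
  proof (rule eq_vecI)
    fix r assume "r < dim_vec g'"
    then have r: "r < n"
      using g(2) by simp
    have "((\<lambda>j. x powi j * ((?P j *\<^sub>v g) $ r - a j r)) has_sum 0) UNIV" if x: "cmod x = 1" for x
      using has_sum_add[OF S[OF g(1) x r] has_sum_uminusI[OF a[OF x r]]]
      by (simp add: right_diff_distrib)
    then have "(?P 0 *\<^sub>v g) $ r - a 0 r = 0"
      by (rule laurent_constant_coeff_zero)
    then show "g $ r = g' $ r"
      using g(1) a0[OF r] Yc by (simp add: two_sided_power_def del: index_mult_mat_vec)
  qed (use g in auto)
  have solve: "S g x = minv (?L x) *\<^sub>v (Q *\<^sub>v g)" if g: "g \<in> carrier_vec n" and x: "cmod x = 1" for g x
    using LS[OF g x] assoc_mult_mat_vec[OF Li(1)[OF x] Lc Sc, of x g x] Li(3)[OF x] Sc[of g x]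
    by simp
  have detQ: "det Q \<noteq> 0"
  proof
    assume "det Q = 0"
    then obtain g where g: "g \<in> carrier_vec n" "g \<noteq> 0\<^sub>v n" "Q *\<^sub>v g = 0\<^sub>v n"
      using det_0_iff_vec_prod_zero_field[OF Qc] by blast
    have "S g x $ r = 0" if "cmod x = 1" "r < n" for x r
      using solve[OF g(1) that(1)] g(3) Li(1)[OF that(1)] that(2) by simp
    then have "g = 0\<^sub>v n"
      using g(1) by (intro coeff0_unique[where a = "\<lambda>_ _. 0"]) auto
    with g(2) show False ..
  qed
  note Qi = minv_inverse[OF Qc detQ]
  define g where "g = minv Q *\<^sub>v w"
  have g: "g \<in> carrier_vec n" "Q *\<^sub>v g = w"
    using Qi w Qc by (simp_all add: g_def flip: assoc_mult_mat_vec[of _ n n _ n])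
  have "g = H 0 *\<^sub>v w"
  proof (rule coeff0_unique[where a = "\<lambda>j r. (H j *\<^sub>v w) $ r"])
    fix x r assume "cmod x = 1" "r < n"
    then show "((\<lambda>j. x powi j * (H j *\<^sub>v w) $ r) has_sum S g x $ r) UNIV"
      unfolding solve[OF g(1) \<open>cmod x = 1\<close>] g(2)
      by (intro has_sum_mat_entries_vec[OF H Li(1) w] exp)
  qed (use g mult_mat_vec_carrier[OF H w] in auto)
  with S[OF g(1) x r] solve[OF g(1) x] g(2) show ?thesis
    by simp
qed

section \<open>Cyclic reduction averages inverses\<close>

text \<open>Write the Laurent polynomial at \<open>x\<close> as \<open>B0 + W\<close>. Its value at \<open>- x\<close> is \<open>B0 - W\<close>, and
\<open>(B0 + W) * S * (B0 - W) = B0 - W * S * W\<close> for \<open>S\<close> the inverse of \<open>B0\<close>. The terms of \<open>W * S * W\<close> with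
exponents \<open>- 2\<close>, \<open>0\<close> and \<open>2\<close> are exactly the corrections in one step of cyclic reduction.\<close>

lemma laurent_eval_square:
  fixes Bm B0 B1 S :: "complex mat"
  assumes B: "Bm \<in> carrier_mat n n" "B0 \<in> carrier_mat n n" "B1 \<in> carrier_mat n n"
    and S: "S \<in> carrier_mat n n" "B0 * S = 1\<^sub>m n" "S * B0 = 1\<^sub>m n" and x: "x \<noteq> 0"
  shows "laurent_eval (- (Bm * S * Bm)) (B0 - B1 * S * Bm - Bm * S * B1) (- (B1 * S * B1)) (x ^ 2)
    = laurent_eval Bm B0 B1 x * S * laurent_eval Bm B0 B1 (- x)"
proof -
  define W where "W = inverse x \<cdot>\<^sub>m Bm + x \<cdot>\<^sub>m B1"
  have W: "W \<in> carrier_mat n n"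
    using B by (simp add: W_def)
  have L: "laurent_eval Bm B0 B1 x = B0 + W" "laurent_eval Bm B0 B1 (- x) = B0 - W"
    unfolding laurent_eval_def W_def using B by (auto intro!: eq_matI)
  have regroup: "(B0 - W) + (W - (inverse x \<cdot>\<^sub>m (inverse x \<cdot>\<^sub>m P + x \<cdot>\<^sub>m Q)
      + x \<cdot>\<^sub>m (inverse x \<cdot>\<^sub>m U + x \<cdot>\<^sub>m V))) = laurent_eval (- P) (B0 - Q - U) (- V) (x ^ 2)"
    if "P \<in> carrier_mat n n" "Q \<in> carrier_mat n n" "U \<in> carrier_mat n n" "V \<in> carrier_mat n n"
    for P Q U V
    unfolding laurent_eval_def using that B W x
    by (intro eq_matI) (auto simp: field_simps power2_eq_square)
  note [simp] = mult_carrier_mat[of _ n n _ n] S(1) B W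
  have "(B0 + W) * S * (B0 - W) = (1\<^sub>m n + W * S) * (B0 - W)"
    by (simp add: add_mult_distrib_mat[of _ n n _ _ n] S)
  also have "\<dots> = (B0 - W) + W * S * (B0 - W)"
    using left_mult_one_mat[of "B0 - W" n n]
    by (subst add_mult_distrib_mat[of _ n n _ _ n]) (auto simp: minus_carrier_mat)
  also have "W * S * (B0 - W) = W - W * S * W"
    by (subst mult_minus_distrib_mat[of _ n n _ n]) (auto simp: assoc_mult_mat[of _ n n _ n _ n] S right_mult_one_mat[OF W])
  also have "W * S * W = inverse x \<cdot>\<^sub>m (inverse x \<cdot>\<^sub>m (Bm * S * Bm) + x \<cdot>\<^sub>m (B1 * S * Bm))
      + x \<cdot>\<^sub>m (inverse x \<cdot>\<^sub>m (Bm * S * B1) + x \<cdot>\<^sub>m (B1 * S * B1))"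
    unfolding W_def
    by (simp add: add_mult_distrib_mat[of _ n n _ _ n] mult_add_distrib_mat[of _ n n _ n]
        mult_smult_assoc_mat[of _ n n _ n] mult_smult_distrib[of _ n n _ n] del: assoc_mult_mat assoc_add_mat)
  also have "(B0 - W) + (W - \<dots>)
      = laurent_eval (- (Bm * S * Bm)) (B0 - B1 * S * Bm - Bm * S * B1) (- (B1 * S * B1)) (x ^ 2)"
    by (rule regroup) simp_all
  finally show ?thesis
    by (simp add: L)
qed

text \<open>In the factorization of the preceding lemma the roles of \<open>x\<close> and \<open>- x\<close> can be exchanged. Hence \<open>T\<close>
times the sum of the two inverses is the sum of the two Laurent polynomials times \<open>S\<close>; in that sum the odd
terms cancel, which leaves \<open>2\<close> times \<open>B0 * S\<close>.\<close>

lemma minv_laurent_eval_square: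
  fixes Bm B0 B1 S :: "complex mat"
  assumes B: "Bm \<in> carrier_mat n n" "B0 \<in> carrier_mat n n" "B1 \<in> carrier_mat n n"
    and S: "S \<in> carrier_mat n n" "B0 * S = 1\<^sub>m n" "S * B0 = 1\<^sub>m n" and x: "x \<noteq> 0"
    and d: "det (laurent_eval Bm B0 B1 x) \<noteq> 0" "det (laurent_eval Bm B0 B1 (- x)) \<noteq> 0"
  defines "T \<equiv> laurent_eval (- (Bm * S * Bm)) (B0 - B1 * S * Bm - Bm * S * B1) (- (B1 * S * B1)) (x ^ 2)"
  shows "minv T = (1 / 2) \<cdot>\<^sub>m (minv (laurent_eval Bm B0 B1 x) + minv (laurent_eval Bm B0 B1 (- x)))"
    and "det T \<noteq> 0"
proof -
  let ?L = "laurent_eval Bm B0 B1 x" and ?M = "laurent_eval Bm B0 B1 (- x)"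
  note L = laurent_eval_carrier[OF B, of x] and M = laurent_eval_carrier[OF B, of "- x"]
  note Li = minv_inverse[OF L d(1)] and Mi = minv_inverse[OF M d(2)]
  have T: "T = ?L * S * ?M" "T = ?M * S * ?L"
    using laurent_eval_square[OF B S x] laurent_eval_square[OF B S, of "- x"] x by (simp_all add: T_def)
  have Tc: "T \<in> carrier_mat n n"
    unfolding T(1) using L M S(1) by auto
  have TL: "T * minv ?L = ?M * S"
    unfolding T(2) using L M S(1) Li by (simp add: assoc_mult_mat[of _ n n _ n _ n])
  have TM: "T * minv ?M = ?L * S"
    unfolding T(1) using L M S(1) Mi by (simp add: assoc_mult_mat[of _ n n _ n _ n])
  have sum: "?M + ?L = 2 \<cdot>\<^sub>m B0"
    unfolding laurent_eval_def using B by (auto intro!: eq_matI)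
  have "T * ((1 / 2) \<cdot>\<^sub>m (minv ?L + minv ?M)) = (1 / 2) \<cdot>\<^sub>m (T * minv ?L + T * minv ?M)"
    using mult_smult_distrib[OF Tc, of "minv ?L + minv ?M" n "1 / 2"]
      mult_add_distrib_mat[OF Tc Li(1) Mi(1)] Mi(1) by simp
  also have "T * minv ?L + T * minv ?M = (?M + ?L) * S"
    unfolding TL TM using add_mult_distrib_mat[OF M L S(1)] by simp
  also have "\<dots> = 2 \<cdot>\<^sub>m 1\<^sub>m n"
    unfolding sum using mult_smult_assoc_mat[OF B(2) S(1), of 2] S(2) by simp
  also have "(1 / 2 :: complex) \<cdot>\<^sub>m (2 \<cdot>\<^sub>m 1\<^sub>m n) = 1\<^sub>m n"
    by (intro eq_matI) auto
  finally show "minv T = (1 / 2) \<cdot>\<^sub>m (minv ?L + minv ?M)" "det T \<noteq> 0"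
    using minv_unique[OF Tc, of "(1 / 2) \<cdot>\<^sub>m (minv ?L + minv ?M)"] Li(1) Mi(1) by auto
qed

lemma cr_carrier:
  assumes A: "Am \<in> carrier_mat m m" "A0 \<in> carrier_mat m m" "A1 \<in> carrier_mat m m"
    and nb: "cr_no_breakdown Am A0 A1" and cr: "cr Am A0 A1 h = (Bm, B0, B1)"
  shows "Bm \<in> carrier_mat m m" "B0 \<in> carrier_mat m m" "B1 \<in> carrier_mat m m" "det B0 \<noteq> 0"
proof -
  have "Bm \<in> carrier_mat m m \<and> B0 \<in> carrier_mat m m \<and> B1 \<in> carrier_mat m m"
    using cr
  proof (induction h arbitrary: Bm B0 B1)
    case 0
    then show ?case
      using A by simp
  next
    case (Suc h)
    obtain Cm C0 C1 where C: "cr Am A0 A1 h = (Cm, C0, C1)"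
      by (cases "cr Am A0 A1 h") auto
    note Cc = Suc.IH[OF C]
    have "det C0 \<noteq> 0"
      using nb C Cc invertible_mat_det[of C0 m] by (auto simp: cr_no_breakdown_def cr_mid_def dest: spec[of _ h])
    then have "minv C0 \<in> carrier_mat m m"
      using minv_inverse(1) Cc by blast
    with Cc Suc.prems C show ?case
      by (auto simp: Let_def minus_carrier_mat mult_carrier_mat[of _ m m _ m])
  qed
  then show "Bm \<in> carrier_mat m m" "B0 \<in> carrier_mat m m" "B1 \<in> carrier_mat m m" "det B0 \<noteq> 0"
    using nb cr invertible_mat_det[of B0 m] by (auto simp: cr_no_breakdown_def cr_mid_def dest: spec[of _ h])
qed

lemma cr_psi_average:
  assumes A: "Am \<in> carrier_mat m m" "A0 \<in> carrier_mat m m" "A1 \<in> carrier_mat m m"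
    and nb: "cr_no_breakdown Am A0 A1"
    and inv: "\<And>x. cmod x = 1 \<Longrightarrow> det (laurent_eval Am A0 A1 x) \<noteq> 0"
    and x: "cmod x = 1"
  shows "cr_phi Am A0 A1 h x \<in> carrier_mat m m" "det (cr_phi Am A0 A1 h x) \<noteq> 0"
    "cr_psi Am A0 A1 (Suc h) (x ^ 2) = (1 / 2) \<cdot>\<^sub>m (cr_psi Am A0 A1 h x + cr_psi Am A0 A1 h (- x))"
proof -
  have step: "det (cr_phi Am A0 A1 (Suc h) (x ^ 2)) \<noteq> 0 \<and>
      cr_psi Am A0 A1 (Suc h) (x ^ 2) = (1 / 2) \<cdot>\<^sub>m (cr_psi Am A0 A1 h x + cr_psi Am A0 A1 h (- x))"
    if det: "\<And>y. cmod y = 1 \<Longrightarrow> det (cr_phi Am A0 A1 h y) \<noteq> 0" and x: "cmod x = 1" for h x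
  proof -
    obtain Bm B0 B1 where B: "cr Am A0 A1 h = (Bm, B0, B1)"
      by (cases "cr Am A0 A1 h") auto
    note Bc = cr_carrier[OF A nb B]
    have "x \<noteq> 0"
      using x by auto
    then show ?thesis
      using minv_laurent_eval_square[OF Bc(1-3) minv_inverse[OF Bc(2,4)], of x] det[of x] det[of "- x"] x
      by (simp add: cr_phi_def cr_psi_def B Let_def)
  qed
  have det: "det (cr_phi Am A0 A1 h x) \<noteq> 0" if "cmod x = 1" for h x
    using that
  proof (induction h arbitrary: x)
    case 0
    then show ?case
      using inv by (simp add: cr_phi_def)
  next
    case (Suc h)
    then show ?case
      using step[of h] by (metis cmod_square_root_on_circle)
  qed
  show "det (cr_phi Am A0 A1 h x) \<noteq> 0"
    using det[OF x] .
  show "cr_psi Am A0 A1 (Suc h) (x ^ 2) = (1 / 2) \<cdot>\<^sub>m (cr_psi Am A0 A1 h x + cr_psi Am A0 A1 h (- x))"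
    using step[OF det x] by blast
  obtain Bm B0 B1 where B: "cr Am A0 A1 h = (Bm, B0, B1)"
    by (cases "cr Am A0 A1 h") auto
  show "cr_phi Am A0 A1 h x \<in> carrier_mat m m"
    using laurent_eval_carrier[OF cr_carrier(1-3)[OF A nb B]] by (simp add: cr_phi_def B)
qed

section \<open>Blocks of the inverse\<close>

lemma lower_left_carrier:
  "M \<in> carrier_mat (q + p) (q + p) \<Longrightarrow> lower_left q M \<in> carrier_mat p q"
  by (simp add: lower_left_def split_block_def Let_def)

lemma lower_left_entry:
  "M \<in> carrier_mat (q + p) (q + p) \<Longrightarrow> r < p \<Longrightarrow> c < q \<Longrightarrow> lower_left q M $$ (r, c) = M $$ (q + r, c)"
  by (simp add: lower_left_def split_block_def Let_def add.commute)

lemma lower_right_carrier: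
  "M \<in> carrier_mat (q + p) (q + p) \<Longrightarrow> lower_right q M \<in> carrier_mat p p"
  by (simp add: lower_right_def split_block_def Let_def)

lemma lower_right_entry:
  "M \<in> carrier_mat (q + p) (q + p) \<Longrightarrow> r < p \<Longrightarrow> c < p
    \<Longrightarrow> lower_right q M $$ (r, c) = M $$ (q + r, q + c)"
  by (simp add: lower_right_def split_block_def Let_def add.commute)

lemma lower_right_laurent_eval:
  assumes "Bm \<in> carrier_mat (q + p) (q + p)" "B0 \<in> carrier_mat (q + p) (q + p)" "B1 \<in> carrier_mat (q + p) (q + p)"
  shows "lower_right q (laurent_eval Bm B0 B1 x)
    = laurent_eval (lower_right q Bm) (lower_right q B0) (lower_right q B1) x"
  using assms by (intro eq_matI) (auto simp: lower_right_def split_block_def Let_def laurent_eval_def)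

lemma sum_lessThan_add:
  fixes f :: "nat \<Rightarrow> complex"
  shows "(\<Sum>k<q + p. f k) = (\<Sum>k<q. f k) + (\<Sum>k<p. f (q + k))"
  by (induction p) (auto simp: add.assoc)

text \<open>The lower block row of \<open>M * minv M = 1\<close>, read in a column \<open>c\<close> of the left half, says that the lower
right block of \<open>M\<close> times the lower left block of the inverse is the negative of the dyad times the upper
left block of the inverse. Padding \<open>v\<close> with zeros lets the full inverse stand in for its upper left
block.\<close>

lemma lower_left_inverse_dyad:
  assumes M: "M \<in> carrier_mat (q + p) (q + p)" and dM: "det M \<noteq> 0"
    and dD: "det (lower_right q M) \<noteq> 0"
    and u: "u \<in> carrier_vec p" and v: "v \<in> carrier_vec q" and C: "lower_left q M = dyad u v"
    and r: "r < p" and c: "c < q"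
  shows "lower_left q (minv M) $$ (r, c)
    = - ((minv (lower_right q M) *\<^sub>v u) $ r * (transpose_mat (minv M) *\<^sub>v (v @\<^sub>v 0\<^sub>v p)) $ c)"
proof -
  let ?N = "minv M" and ?D = "lower_right q M"
  note N = minv_inverse[OF M dM]
  note D = lower_right_carrier[OF M] and Di = minv_inverse[OF lower_right_carrier[OF M] dD]
  define \<beta> where "\<beta> = (\<Sum>k<q. v $ k * ?N $$ (k, c))"
  define y where "y = vec p (\<lambda>k. ?N $$ (q + k, c))"
  have y: "y \<in> carrier_vec p"
    by (simp add: y_def)
  have "(transpose_mat ?N *\<^sub>v (v @\<^sub>v 0\<^sub>v p)) $ c
      = (\<Sum>k<q + p. transpose_mat ?N $$ (c, k) * (v @\<^sub>v 0\<^sub>v p) $ k)"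
    using c v N(1) by (intro mat_vec_entry[of _ "q + p"]) auto
  also have "\<dots> = \<beta>"
    using c v N(1) by (simp add: sum_lessThan_add \<beta>_def mult.commute)
  finally have \<beta>: "(transpose_mat ?N *\<^sub>v (v @\<^sub>v 0\<^sub>v p)) $ c = \<beta>" .
  have "?D *\<^sub>v y = (- \<beta>) \<cdot>\<^sub>v u"
  proof (rule eq_vecI)
    fix i assume "i < dim_vec ((- \<beta>) \<cdot>\<^sub>v u)"
    then have i: "i < p"
      using u by simp
    have "M $$ (q + i, k) = u $ i * v $ k" if "k < q" for k
      using lower_left_entry[OF M i that] C u v i that by (simp add: dyad_def)
    then have "(M * ?N) $$ (q + i, c) = u $ i * \<beta> + (\<Sum>k<p. M $$ (q + i, q + k) * ?N $$ (q + k, c))"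
      using i c by (subst mat_mat_entry[OF M N(1)])
        (auto simp: sum_lessThan_add \<beta>_def sum_distrib_left mult.assoc)
    also have "(\<Sum>k<p. M $$ (q + i, q + k) * ?N $$ (q + k, c)) = (?D *\<^sub>v y) $ i"
      unfolding mat_vec_entry[OF D y i]
      by (intro sum.cong) (auto simp: lower_right_entry[OF M i] y_def)
    also have "(M * ?N) $$ (q + i, c) = 0"
      using N(2) i c by simp
    finally have "(?D *\<^sub>v y) $ i = - (\<beta> * u $ i)"
      by (simp add: eq_neg_iff_add_eq_0 add.commute mult.commute)
    then show "(?D *\<^sub>v y) $ i = ((- \<beta>) \<cdot>\<^sub>v u) $ i"
      using u i by simp
  qed (use u D in auto)
  then have "minv ?D *\<^sub>v (?D *\<^sub>v y) = (- \<beta>) \<cdot>\<^sub>v (minv ?D *\<^sub>v u)"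
    using mult_mat_vec[OF Di(1) u] by simp
  also have "minv ?D *\<^sub>v (?D *\<^sub>v y) = y"
    using assoc_mult_mat_vec[OF Di(1) D y] Di(3) y by simp
  finally have "y $ r = - \<beta> * (minv ?D *\<^sub>v u) $ r"
    using Di(1) r by simp
  then show ?thesis
    using lower_left_entry[OF N(1) r c] r \<beta> by (simp add: y_def)
qed

section \<open>Transposition and Krylov matrices\<close>

lemma add_mat_reverse:
  fixes A B C :: "complex mat"
  assumes "A \<in> carrier_mat n n" "B \<in> carrier_mat n n" "C \<in> carrier_mat n n"
  shows "A + B + C = C + B + A"
  using assms by (intro eq_matI) auto

text \<open>Transposition exchanges the equations solved by matrices multiplying from the left with those solved by
matrices multiplying from the right.\<close>

lemma transpose_quadratic_eq:
  fixes P Q U Z :: "complex mat"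
  assumes P: "P \<in> carrier_mat n n" and Q: "Q \<in> carrier_mat n n" and U: "U \<in> carrier_mat n n"
    and Z: "Z \<in> carrier_mat n n" and eq: "P + Z * Q + Z * Z * U = 0\<^sub>m n n"
  shows "transpose_mat P + transpose_mat Q * transpose_mat Z
    + transpose_mat U * (transpose_mat Z * transpose_mat Z) = 0\<^sub>m n n"
proof -
  have c: "Z * Q \<in> carrier_mat n n" "Z * Z \<in> carrier_mat n n" "Z * Z * U \<in> carrier_mat n n"
    using mult_carrier_mat[of _ n n _ n] Z Q U by blast+
  have "transpose_mat (P + Z * Q + Z * Z * U) = transpose_mat P + transpose_mat Q * transpose_mat Z
      + transpose_mat U * (transpose_mat Z * transpose_mat Z)"
    unfolding transpose_add[OF add_carrier_mat[OF c(1)] c(3)] transpose_add[OF P c(1)]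
      transpose_mult[OF Z Q] transpose_mult[OF c(2) U] transpose_mult[OF Z Z] ..
  then show ?thesis
    by (simp add: eq)
qed

lemma krylov_carrier: "w \<in> carrier_vec n \<Longrightarrow> krylov N M w \<in> carrier_mat n N"
  unfolding krylov_def by (metis carrier_vecD length_map length_upt mat_of_cols_carrier(1) minus_nat.diff_0)

lemma krylov_entry:
  "w \<in> carrier_vec n \<Longrightarrow> i < n \<Longrightarrow> j < N \<Longrightarrow> krylov N M w $$ (i, j) = (M ^\<^sub>m j *\<^sub>v w) $ i"
  by (simp add: krylov_def mat_of_cols_index del: index_mult_mat_vec)

lemma mult_transpose_entry:
  fixes K L :: "complex mat"
  assumes "K \<in> carrier_mat p N" "L \<in> carrier_mat m N" "r < p" "c < m"
  shows "(K * transpose_mat L) $$ (r, c) = (\<Sum>j<N. K $$ (r, j) * L $$ (c, j))"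
  using assms by (subst mat_mat_entry[of _ p N _ m]) auto

lemma mult_counter_id_entry:
  assumes K: "K \<in> carrier_mat p N" and r: "r < p" and j: "j < N"
  shows "(K * counter_id N) $$ (r, j) = K $$ (r, N - 1 - j)"
proof -
  have "(K * counter_id N) $$ (r, j) = (\<Sum>k<N. K $$ (r, k) * (if k + j + 1 = N then 1 else 0))"
    using r j by (subst mat_mat_entry[OF K, of _ N]) (auto simp: counter_id_def)
  also have "\<dots> = (\<Sum>k<N. if k = N - 1 - j then K $$ (r, k) else 0)"
    using j by (intro sum.cong) auto
  finally show ?thesis
    using j by simp
qed

lemma mult_identity_over_zero_entry:
  fixes T :: "complex mat"
  assumes T: "T \<in> carrier_mat p (q + p)" and r: "r < p" and c: "c < q"
  shows "(T * (1\<^sub>m q @\<^sub>r 0\<^sub>m p q)) $$ (r, c) = T $$ (r, c)"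
proof -
  have "(T * (1\<^sub>m q @\<^sub>r 0\<^sub>m p q)) $$ (r, c)
      = (\<Sum>k<q + p. T $$ (r, k) * (1\<^sub>m q @\<^sub>r 0\<^sub>m p q) $$ (k, c))"
    using r c by (intro mat_mat_entry[OF T]) auto
  also have "\<dots> = (\<Sum>k<q + p. if k = c then T $$ (r, k) else 0)"
    using c by (intro sum.cong) (auto simp: append_rows_def)
  finally show ?thesis
    using c by simp
qed

lemma transpose_smult: "transpose_mat (c \<cdot>\<^sub>m A) = c \<cdot>\<^sub>m transpose_mat A"
  by (intro eq_matI) auto

lemma transpose_mat_infsum:
  assumes "\<And>s. F s \<in> carrier_mat n n"
  shows "transpose_mat (mat_infsum n F S) = mat_infsum n (\<lambda>s. transpose_mat (F s)) S"
  using carrier_matD[OF assms]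
  by (intro eq_matI) (auto simp: mat_infsum_def intro!: infsum_cong index_transpose_mat(1)[symmetric])

section \<open>The Krylov form of the lower left block\<close>

lemma monomial_product:
  fixes x s s' :: complex
  assumes "x \<noteq> 0"
  shows "(x powi i * s) * (inverse x powi k * s') = x powi (i - k) * (s * s')"
  using assms by (simp add: power_int_diff power_int_inverse field_simps)

text \<open>Both factors of the dyadic product are instances of the two-sided expansion. For the factor from \<open>\<psi>\<close>
it is applied to the transpose of \<open>\<phi>\<close> at the inverse argument. This exchanges the outer
coefficients, so that the powers of \<open>Rhat\<close> stand at the non-negative and those of \<open>R\<close> at the negative
exponents of \<open>inverse x\<close>, and the two exponents \<open>i\<close> and \<open>k\<close> contribute the monomial \<open>x powi (i - k)\<close>.\<close>

theorem lemma3p2: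
  fixes m p h :: nat
    and Am A0 A1 Dm D0 D1 R Rhat G Ghat :: "complex mat"
    and H\<psi> HD :: "int \<Rightarrow> complex mat"
    and \<phi> \<psi> D :: "complex \<Rightarrow> complex mat"
    and t tD :: real
    and z :: complex
    and u v vhat a b ahat bhat :: "complex vec"
  assumes p: "0 < p" "p < m"
    and A_carrier: "Am \<in> carrier_mat m m" "A0 \<in> carrier_mat m m" "A1 \<in> carrier_mat m m"
    and no_breakdown: "cr_no_breakdown Am A0 A1"
    and \<phi>_def: "\<phi> = laurent_eval Am A0 A1"
    and \<psi>_def: "\<psi> = (\<lambda>x. minv (\<phi> x))"
    and D_coeffs: "Dm = lower_right (m - p) Am" "D0 = lower_right (m - p) A0"
      "D1 = lower_right (m - p) A1"
    and D_def: "D = laurent_eval Dm D0 D1"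
    and splitting_\<phi>: "splitting m t Am A0 A1"
    and splitting_D: "splitting p tD Dm D0 D1"
    and R: "R \<in> carrier_mat m m" "spectral_radius R < 1"
      "A1 + R * A0 + R * R * Am = 0\<^sub>m m m"
    and Rhat: "Rhat \<in> carrier_mat m m" "spectral_radius Rhat < 1"
      "Rhat * Rhat * A1 + Rhat * A0 + Am = 0\<^sub>m m m"
    and RD_ex: "\<exists>RD \<in> carrier_mat p p. spectral_radius RD < 1 \<and>
      D1 + RD * D0 + RD * RD * Dm = 0\<^sub>m p p"
    and RDhat_ex: "\<exists>RDhat \<in> carrier_mat p p. spectral_radius RDhat < 1 \<and>
      RDhat * RDhat * D1 + RDhat * D0 + Dm = 0\<^sub>m p p"
    and H\<psi>: "laurent_expansion m t (1 / t) \<psi> H\<psi>"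
    and HD: "laurent_expansion p tD (1 / tD) (\<lambda>x. minv (D x)) HD"
    and G: "G \<in> carrier_mat p p" "spectral_radius G < 1"
      "D1 * (G * G) + D0 * G + Dm = 0\<^sub>m p p"
    and Ghat: "Ghat \<in> carrier_mat p p" "spectral_radius Ghat < 1"
      "D1 + D0 * Ghat + Dm * (Ghat * Ghat) = 0\<^sub>m p p"
    and z: "cmod z = 1"
    and uv: "u \<in> carrier_vec p" "v \<in> carrier_vec (m - p)"
    and C_dyad: "\<forall>x. x \<noteq> 0 \<longrightarrow> lower_left (m - p) (\<phi> x) = dyad u v"
    and vhat_def: "vhat = v @\<^sub>v 0\<^sub>v p"
    and a_def: "a = mat_infsum p (\<lambda>s. z powi (- int s - 1) \<cdot>\<^sub>m (G ^\<^sub>m (s + 1))) {s. 2 ^ h dvd s}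
      *\<^sub>v (HD 0 *\<^sub>v u)"
    and b_def: "b = transpose_mat
        (mat_infsum m (\<lambda>s. z ^ (s + 1) \<cdot>\<^sub>m (R ^\<^sub>m (s + 1))) {s. 2 ^ h dvd s})
      *\<^sub>v (transpose_mat (H\<psi> 0) *\<^sub>v vhat)"
    and ahat_def: "ahat = mat_infsum p (\<lambda>s. z ^ s \<cdot>\<^sub>m (Ghat ^\<^sub>m s)) {s. 2 ^ h dvd s}
      *\<^sub>v (HD 0 *\<^sub>v u)"
    and bhat_def: "bhat = transpose_mat
        (mat_infsum m (\<lambda>s. z powi (- int s) \<cdot>\<^sub>m (Rhat ^\<^sub>m s)) {s. 2 ^ h dvd s})
      *\<^sub>v (transpose_mat (H\<psi> 0) *\<^sub>v vhat)"
  shows "- lower_left (m - p) (cr_psi Am A0 A1 h (z ^ (2 ^ h))) =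
    (krylov (2 ^ h) Ghat ahat * transpose_mat (krylov (2 ^ h) (transpose_mat Rhat) bhat)
     + z powi (2 ^ h - 1) \<cdot>\<^sub>m (krylov (2 ^ h) Ghat ahat * counter_id (2 ^ h)
         * transpose_mat (krylov (2 ^ h) (transpose_mat R) b))
     + z powi (1 - 2 ^ h) \<cdot>\<^sub>m (krylov (2 ^ h) G a * counter_id (2 ^ h)
         * transpose_mat (krylov (2 ^ h) (transpose_mat Rhat) bhat))
     + krylov (2 ^ h) G a * transpose_mat (krylov (2 ^ h) (transpose_mat R) b))
    * (1\<^sub>m (m - p) @\<^sub>r 0\<^sub>m p (m - p))"
proof -
  define N :: nat where "N = 2 ^ h"
  define q where "q = m - p"
  have m: "m = q + p" and m0: "0 < m" and N0: "0 < N"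
    using p by (simp_all add: q_def N_def)
  note Aq = A_carrier[unfolded m]
  have Dc: "Dm \<in> carrier_mat p p" "D0 \<in> carrier_mat p p" "D1 \<in> carrier_mat p p"
    using lower_right_carrier Aq by (simp_all add: D_coeffs flip: q_def)
  have Dx: "lower_right q (\<phi> x) = D x" for x
    using lower_right_laurent_eval[OF Aq] by (simp add: \<phi>_def D_def D_coeffs flip: q_def)
  have \<phi>c: "\<phi> x \<in> carrier_mat m m" for x
    unfolding \<phi>_def by (rule laurent_eval_carrier[OF A_carrier])
  have det\<phi>: "det (\<phi> x) \<noteq> 0" if "cmod x = 1" for x
    unfolding \<phi>_def by (rule splitting_det_nonzero[OF A_carrier m0 splitting_\<phi> that])
  have detD: "det (D x) \<noteq> 0" if "cmod x = 1" for x
    unfolding D_def by (rule splitting_det_nonzero[OF Dc p(1) splitting_D that])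
  have annulus: "t < cmod x" "cmod x < 1 / t" "tD < cmod x" "cmod x < 1 / tD" if "cmod x = 1" for x
    using splitting_\<phi> splitting_D that by (auto simp: splitting_def)

  let ?RT = "transpose_mat R" and ?RhT = "transpose_mat Rhat"
  let ?gD = "HD 0 *\<^sub>v u" and ?g\<psi> = "transpose_mat (H\<psi> 0) *\<^sub>v vhat"
  have G': "power_summable p G" "power_summable p Ghat"
    using spectral_radius_less_1_power_summable p(1) G(1,2) Ghat(1,2) by blast+
  have R': "power_summable m ?RT" "power_summable m ?RhT"
    using spectral_radius_less_1_power_summable power_summable_transpose m0 R(1,2) Rhat(1,2) by blast+
  have HDc: "HD j \<in> carrier_mat p p" for j
    using HD by (simp add: laurent_expansion_def)
  have H\<psi>c: "H\<psi> j \<in> carrier_mat m m" for j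
    using H\<psi> by (simp add: laurent_expansion_def)
  have vhat: "vhat \<in> carrier_vec m"
    using uv(2) by (simp add: vhat_def m flip: q_def)
  have gD: "?gD \<in> carrier_vec p"
    using mult_mat_vec_carrier[OF HDc uv(1)] .
  have g\<psi>: "?g\<psi> \<in> carrier_vec m"
    using mult_mat_vec_carrier[of "transpose_mat (H\<psi> 0)" m m vhat] H\<psi>c vhat by simp

  have D_series: "((\<lambda>i. x powi i * (two_sided_power G Ghat i *\<^sub>v ?gD) $ r)
      has_sum (minv (D x) *\<^sub>v u) $ r) UNIV" if x: "cmod x = 1" and r: "r < p" for x r
    unfolding D_def
  proof (rule inverse_two_sided_power_expansion[OF Dc G'(1) G(3) G'(2) Ghat(3) _ HDc _ uv(1) x r])
    show "det (laurent_eval Dm D0 D1 x) \<noteq> 0" if "cmod x = 1" for x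
      using detD[OF that] by (simp add: D_def)
    show "((\<lambda>j. x powi j * HD j $$ (i, k)) has_sum minv (laurent_eval Dm D0 D1 x) $$ (i, k)) UNIV"
      if "cmod x = 1" "i < p" "k < p" for x i k
      using HD annulus[OF that(1)] that(2,3) by (auto simp: laurent_expansion_def D_def)
  qed

  have reversal: "laurent_eval (transpose_mat A1) (transpose_mat A0) (transpose_mat Am) x
      = transpose_mat (\<phi> (inverse x))" for x
    unfolding \<phi>_def laurent_eval_def using A_carrier by (intro eq_matI) auto
  have reversal_inv: "minv (laurent_eval (transpose_mat A1) (transpose_mat A0) (transpose_mat Am) x)
      = transpose_mat (\<psi> (inverse x))" if "cmod x = 1" for x
    unfolding reversal \<psi>_def using that by (intro minv_transpose[OF \<phi>c] det\<phi>) (simp add: norm_inverse)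
  have sq: "M * N \<in> carrier_mat m m" if "M \<in> carrier_mat m m" "N \<in> carrier_mat m m" for M N :: "complex mat"
    using that by (rule mult_carrier_mat)
  have RT_eq: "transpose_mat Am * (?RT * ?RT) + transpose_mat A0 * ?RT + transpose_mat A1 = 0\<^sub>m m m"
    using transpose_quadratic_eq[OF A_carrier(3,2,1) R(1,3)] A_carrier R(1)
    by (subst add_mat_reverse[of _ m]) (auto intro!: sq simp del: assoc_add_mat assoc_mult_mat)
  have "Am + Rhat * A0 + Rhat * Rhat * A1 = 0\<^sub>m m m"
    using Rhat(3) A_carrier Rhat(1)
    by (subst add_mat_reverse[of _ m]) (auto intro!: sq simp del: assoc_add_mat assoc_mult_mat)
  note RhT_eq = transpose_quadratic_eq[OF A_carrier Rhat(1) this]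
  have \<psi>_series: "((\<lambda>k. inverse x powi k * (two_sided_power ?RT ?RhT k *\<^sub>v ?g\<psi>) $ c)
      has_sum (transpose_mat (\<psi> x) *\<^sub>v vhat) $ c) UNIV" if x: "cmod x = 1" and c: "c < m" for x c
  proof -
    have ix: "cmod (inverse x) = 1"
      using x by (simp add: norm_inverse)
    have "((\<lambda>k. inverse x powi k * (two_sided_power ?RT ?RhT k *\<^sub>v (transpose_mat (H\<psi> (- 0)) *\<^sub>v vhat)) $ c)
        has_sum (minv (laurent_eval (transpose_mat A1) (transpose_mat A0) (transpose_mat Am) (inverse x)) *\<^sub>v vhat) $ c) UNIV"
    proof (rule inverse_two_sided_power_expansion[where H = "\<lambda>j. transpose_mat (H\<psi> (- j))",
          OF _ _ _ R'(1) RT_eq R'(2) RhT_eq _ _ _ vhat ix c])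
      fix y i k assume y: "cmod y = 1" and ik: "i < m" "k < m"
      have y': "cmod (inverse y) = 1"
        using y by (simp add: norm_inverse)
      have "((\<lambda>j. inverse y powi j * H\<psi> j $$ (k, i)) has_sum \<psi> (inverse y) $$ (k, i)) UNIV"
        using H\<psi> annulus[OF y'] ik by (auto simp: laurent_expansion_def)
      also have "?this \<longleftrightarrow> ((\<lambda>j. y powi j * transpose_mat (H\<psi> (- j)) $$ (i, k))
          has_sum \<psi> (inverse y) $$ (k, i)) UNIV"
        by (rule has_sum_reindex_bij_witness[where i = uminus and j = uminus])
          (use carrier_matD[OF H\<psi>c] ik in \<open>auto simp: power_int_minus power_int_inverse\<close>)
      also have "\<psi> (inverse y) $$ (k, i)
          = minv (laurent_eval (transpose_mat A1) (transpose_mat A0) (transpose_mat Am) y) $$ (i, k)"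
        using minv_inverse(1)[OF \<phi>c det\<phi>[OF y']] ik by (simp add: reversal_inv[OF y] \<psi>_def)
      finally show "((\<lambda>j. y powi j * transpose_mat (H\<psi> (- j)) $$ (i, k)) has_sum
          minv (laurent_eval (transpose_mat A1) (transpose_mat A0) (transpose_mat Am) y) $$ (i, k)) UNIV" .
    next
      fix y assume "cmod y = 1"
      then show "det (laurent_eval (transpose_mat A1) (transpose_mat A0) (transpose_mat Am) y) \<noteq> 0"
        unfolding reversal using det\<phi>[of "inverse y"] by (simp add: det_transpose[OF \<phi>c] norm_inverse)
    qed (use A_carrier H\<psi>c in auto)
    then show ?thesis
      by (simp add: reversal_inv[OF ix])
  qed

  have cz: "cmod (inverse z) = 1" and z0: "z \<noteq> 0"
    using z by (auto simp: norm_inverse)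
  have a: "a = mat_infsum p (\<lambda>s. z powi (- int s - 1) \<cdot>\<^sub>m G ^\<^sub>m (s + 1)) {s. N dvd s} *\<^sub>v ?gD"
    and ahat: "ahat = mat_infsum p (\<lambda>s. z ^ s \<cdot>\<^sub>m Ghat ^\<^sub>m s) {s. N dvd s} *\<^sub>v ?gD"
    by (simp_all add: a_def ahat_def N_def)
  have b: "b = mat_infsum m (\<lambda>s. inverse z powi (- int s - 1) \<cdot>\<^sub>m ?RT ^\<^sub>m (s + 1)) {s. N dvd s} *\<^sub>v ?g\<psi>"
  proof -
    have "inverse z powi (- int s - 1) = z ^ (s + 1)" for s
    proof -
      have "- int s - 1 = - int (s + 1)"
        by simp
      then show ?thesis
        by (simp only: power_int_minus power_int_inverse power_inverse inverse_inverse_eq power_int_of_nat)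
    qed
    then show ?thesis
      unfolding b_def N_def
      by (subst transpose_mat_infsum)
        (use R(1) pow_carrier_mat[OF R(1)] in \<open>auto simp: pow_mat_transpose transpose_smult simp del: pow_mat.simps\<close>)
  qed
  have bhat: "bhat = mat_infsum m (\<lambda>s. inverse z ^ s \<cdot>\<^sub>m ?RhT ^\<^sub>m s) {s. N dvd s} *\<^sub>v ?g\<psi>"
    unfolding bhat_def N_def
    by (subst transpose_mat_infsum)
      (use Rhat(1) pow_carrier_mat[OF Rhat(1)] in \<open>auto simp: pow_mat_transpose transpose_smult power_int_minus power_inverse\<close>)
  have vecs: "a \<in> carrier_vec p" "ahat \<in> carrier_vec p" "b \<in> carrier_vec m" "bhat \<in> carrier_vec m"
    unfolding a ahat b bhat by (rule mult_mat_vec_carrier[OF mat_infsum_carrier], rule gD g\<psi>)+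

  let ?KGh = "krylov N Ghat ahat" and ?KG = "krylov N G a"
  let ?KRh = "krylov N ?RhT bhat" and ?KR = "krylov N ?RT b"
  note K = krylov_carrier[OF vecs(1)] krylov_carrier[OF vecs(2)] krylov_carrier[OF vecs(3)] krylov_carrier[OF vecs(4)]
  have Jc: "counter_id N \<in> carrier_mat N N"
    by (simp add: counter_id_def)
  let ?T = "?KGh * transpose_mat ?KRh
     + z powi (int N - 1) \<cdot>\<^sub>m (?KGh * counter_id N * transpose_mat ?KR)
     + z powi (1 - int N) \<cdot>\<^sub>m (?KG * counter_id N * transpose_mat ?KRh)
     + ?KG * transpose_mat ?KR"
  have Kprod: "?KGh * transpose_mat ?KRh \<in> carrier_mat p m"
    "?KGh * counter_id N * transpose_mat ?KR \<in> carrier_mat p m"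
    "?KG * counter_id N * transpose_mat ?KRh \<in> carrier_mat p m"
    "?KG * transpose_mat ?KR \<in> carrier_mat p m"
    using K Jc by (meson mult_carrier_mat transpose_carrier_mat)+
  then have Tc: "?T \<in> carrier_mat p m"
    by simp
  let ?C = "lower_left q (cr_psi Am A0 A1 h (z ^ N))"
  have cr_psi_c: "cr_psi Am A0 A1 k x \<in> carrier_mat m m" if "cmod x = 1" for k x
    unfolding cr_psi_def
    using cr_psi_average(1,2)[OF A_carrier no_breakdown det\<phi>[unfolded \<phi>_def] that] by (rule minv_inverse(1))
  have zN: "cmod (z ^ N) = 1"
    using z by (simp add: norm_power)

  have entry: "- (?C $$ (r, c)) = ?T $$ (r, c)" if r: "r < p" and c: "c < q" for r c
  proof -
    have cm: "c < m"
      using c m by simp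
    let ?\<alpha> = "\<lambda>i. (two_sided_power G Ghat i *\<^sub>v ?gD) $ r"
    let ?\<beta> = "\<lambda>k. (two_sided_power ?RT ?RhT k *\<^sub>v ?g\<psi>) $ c"
    let ?f = "\<lambda>k x. - (lower_left q (cr_psi Am A0 A1 k x) $$ (r, c))"
    \<comment> \<open>cyclic reduction keeps the pairs of exponents whose difference is divisible by \<open>N\<close>\<close>
    have "((\<lambda>e. (z ^ N) powi ((fst e - snd e) div 2 ^ h) * (?\<alpha> (fst e) * ?\<beta> (snd e)))
        has_sum ?f h (z ^ N)) {e \<in> UNIV. 2 ^ h dvd fst e - snd e}"
    proof (rule repeated_even_part[OF _ _ zN])
      fix k :: nat and x :: complex assume x: "cmod x = 1"
      then have "lower_left q (cr_psi Am A0 A1 (Suc k) (x ^ 2)) $$ (r, c)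
          = (1 / 2) * (lower_left q (cr_psi Am A0 A1 k x) $$ (r, c)
            + lower_left q (cr_psi Am A0 A1 k (- x)) $$ (r, c))"
        using cr_psi_c[of x k] cr_psi_c[of "- x" k] r c
        by (simp add: cr_psi_average(3)[OF A_carrier no_breakdown det\<phi>[unfolded \<phi>_def] x]
            lower_left_entry[of _ q p] m)
      then show "?f (Suc k) (x ^ 2) = (?f k x + ?f k (- x)) / 2"
        by simp
    next
      fix x :: complex assume x: "cmod x = 1"
      then have x0: "x \<noteq> 0"
        by auto
      have "?f 0 x = (minv (D x) *\<^sub>v u) $ r * (transpose_mat (\<psi> x) *\<^sub>v vhat) $ c"
        using lower_left_inverse_dyad[OF \<phi>c[unfolded m] det\<phi>[OF x] _ uv(1) _ _ r c, of v] detD[OF x]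
          C_dyad x0 uv(2)
        by (simp add: cr_psi_def cr_phi_def \<psi>_def Dx vhat_def flip: \<phi>_def q_def)
      moreover have "((\<lambda>(i, k). (x powi i * ?\<alpha> i) * (inverse x powi k * ?\<beta> k)) has_sum
          (minv (D x) *\<^sub>v u) $ r * (transpose_mat (\<psi> x) *\<^sub>v vhat) $ c) (UNIV \<times> UNIV)"
        by (rule has_sum_mult_Times[OF D_series[OF x r] \<psi>_series[OF x cm]])
      ultimately show "((\<lambda>e. x powi (fst e - snd e) * (?\<alpha> (fst e) * ?\<beta> (snd e))) has_sum ?f 0 x) UNIV"
        by (simp only: monomial_product[OF x0] split_def UNIV_Times_UNIV)
    qed
    also have "?this \<longleftrightarrow> ((\<lambda>(i, k). (z powi i * ?\<alpha> i) * (inverse z powi k * ?\<beta> k))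
        has_sum ?f h (z ^ N)) {(i, k). int N dvd i - k}"
    proof (rule has_sum_cong_neutral)
      fix e assume "e \<in> {e \<in> UNIV. 2 ^ h dvd fst e - snd e} \<inter> {(i, k). int N dvd i - k}"
      then have "int N * ((fst e - snd e) div 2 ^ h) = fst e - snd e"
        by (simp add: N_def)
      then have "(z ^ N) powi ((fst e - snd e) div 2 ^ h) = z powi (fst e - snd e)"
        by (metis power_int_mult power_int_of_nat)
      then show "(z ^ N) powi ((fst e - snd e) div 2 ^ h) * (?\<alpha> (fst e) * ?\<beta> (snd e))
          = (case e of (i, k) \<Rightarrow> (z powi i * ?\<alpha> i) * (inverse z powi k * ?\<beta> k))"
        by (simp only: monomial_product[OF z0] case_prod_beta)
    qed (auto simp: N_def)
    finally have cr_series: "((\<lambda>(i, k). (z powi i * ?\<alpha> i) * (inverse z powi k * ?\<beta> k))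
        has_sum ?f h (z ^ N)) {(i, k). int N dvd i - k}" .
    let ?Gh_a = "\<lambda>j. (Ghat ^\<^sub>m j *\<^sub>v ahat) $ r" and ?G_a = "\<lambda>j. (G ^\<^sub>m j *\<^sub>v a) $ r"
    let ?Rh_b = "\<lambda>j. (?RhT ^\<^sub>m j *\<^sub>v bhat) $ c" and ?R_b = "\<lambda>j. (?RT ^\<^sub>m j *\<^sub>v b) $ c"
    define l where "l j = N - 1 - j" for j
    let ?P = "\<lambda>j. z ^ j * ?Gh_a j + z powi (- int (l j)) * ?G_a (l j)"
    let ?Q = "\<lambda>j. inverse z ^ j * ?Rh_b j + inverse z powi (- int (l j)) * ?R_b (l j)"
    have "((\<lambda>(i, k). (z powi i * ?\<alpha> i) * (inverse z powi k * ?\<beta> k))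
        has_sum (\<Sum>j<N. ?P j * ?Q j)) {(i, k). int N dvd i - k}"
      unfolding l_def a ahat b bhat
      by (intro has_sum_product_by_residue_class N0
          has_sum_two_sided_power_residue_class[OF G' gD z r]
          has_sum_two_sided_power_residue_class[OF R' g\<psi> cz cm])
    with cr_series have "?f h (z ^ N) = (\<Sum>j<N. ?P j * ?Q j)"
      by (rule has_sum_unique)
    \<comment> \<open>the monomials depend on \<open>j\<close> in none of the four products, because \<open>j + l j = N - 1\<close>\<close>
    also have "\<dots> = (\<Sum>j<N. ?Gh_a j * ?Rh_b j + z powi (int N - 1) * (?Gh_a j * ?R_b (l j))
        + z powi (1 - int N) * (?G_a (l j) * ?Rh_b j) + ?G_a (l j) * ?R_b (l j))"
    proof (rule sum.cong)
      fix j assume "j \<in> {..<N}"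
      then have l: "int (l j) = int N - 1 - int j"
        by (simp add: l_def)
      have "z ^ j * inverse z ^ j = 1" "z powi (- int (l j)) * inverse z powi (- int (l j)) = 1"
        using z0 by (simp_all add: power_int_inverse power_inverse)
      moreover have "z ^ j * inverse z powi (- int (l j)) = z powi (int N - 1)"
      proof -
        have "z ^ j * inverse z powi (- int (l j)) = z powi (int j + int (l j))"
          using z0 by (simp add: power_int_inverse power_inverse power_int_minus power_int_add)
        then show ?thesis
          by (simp add: l)
      qed
      moreover have "z powi (- int (l j)) * inverse z ^ j = z powi (1 - int N)"
      proof -
        have "z powi (- int (l j)) * inverse z ^ j = z powi (- int (l j) + - int j)"
          using z0 by (subst power_int_add) (auto simp: power_int_minus power_inverse)
        then show ?thesis
          by (simp add: l)
      qed
      moreover have "(x * A + y * B) * (x' * C + y' * D)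
          = (x * x') * (A * C) + (x * y') * (A * D) + (y * x') * (B * C) + (y * y') * (B * D)"
        for x y x' y' A B C D :: complex
        by (simp add: algebra_simps)
      ultimately show "?P j * ?Q j = ?Gh_a j * ?Rh_b j + z powi (int N - 1) * (?Gh_a j * ?R_b (l j))
          + z powi (1 - int N) * (?G_a (l j) * ?Rh_b j) + ?G_a (l j) * ?R_b (l j)"
        by (simp only: mult_1_left)
    qed simp
    also have "\<dots> = (\<Sum>j<N. ?Gh_a j * ?Rh_b j) + z powi (int N - 1) * (\<Sum>j<N. ?Gh_a j * ?R_b (l j))
        + z powi (1 - int N) * (\<Sum>j<N. ?G_a (l j) * ?Rh_b j) + (\<Sum>j<N. ?G_a (l j) * ?R_b (l j))"
      by (simp only: sum.distrib sum_distrib_left)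
    also have "(\<Sum>j<N. ?G_a (l j) * ?R_b (l j)) = (\<Sum>j<N. ?G_a j * ?R_b j)"
      by (rule sum.reindex_bij_witness[of _ l l]) (auto simp: l_def)
    also have "(\<Sum>j<N. ?Gh_a j * ?R_b (l j)) = (?KGh * counter_id N * transpose_mat ?KR) $$ (r, c)"
    proof -
      have "(?KGh * counter_id N * transpose_mat ?KR) $$ (r, c)
          = (\<Sum>j<N. (?KGh * counter_id N) $$ (r, j) * ?KR $$ (c, j))"
        by (rule mult_transpose_entry[OF mult_carrier_mat[OF _ Jc] _ r cm]) (rule K)+
      also have "\<dots> = (\<Sum>j<N. ?Gh_a (l j) * ?R_b j)"
        by (intro sum.cong) (simp_all add: mult_counter_id_entry[OF K(2) r] krylov_entry[OF vecs(2) r]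
            krylov_entry[OF vecs(3) cm] l_def del: index_mult_mat_vec)
      also have "\<dots> = (\<Sum>j<N. ?Gh_a j * ?R_b (l j))"
        by (rule sum.reindex_bij_witness[of _ l l]) (auto simp: l_def)
      finally show ?thesis
        by simp
    qed
    also have "(\<Sum>j<N. ?G_a (l j) * ?Rh_b j) = (?KG * counter_id N * transpose_mat ?KRh) $$ (r, c)"
    proof -
      have "(?KG * counter_id N * transpose_mat ?KRh) $$ (r, c)
          = (\<Sum>j<N. (?KG * counter_id N) $$ (r, j) * ?KRh $$ (c, j))"
        by (rule mult_transpose_entry[OF mult_carrier_mat[OF _ Jc] _ r cm]) (rule K)+
      also have "\<dots> = (\<Sum>j<N. ?G_a (l j) * ?Rh_b j)"
        by (intro sum.cong) (simp_all add: mult_counter_id_entry[OF K(1) r] krylov_entry[OF vecs(1) r]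
            krylov_entry[OF vecs(4) cm] l_def del: index_mult_mat_vec)
      finally show ?thesis
        by simp
    qed
    also have "(\<Sum>j<N. ?Gh_a j * ?Rh_b j) = (?KGh * transpose_mat ?KRh) $$ (r, c)"
      by (simp add: mult_transpose_entry[OF K(2,4) r cm] krylov_entry[OF vecs(2) r]
          krylov_entry[OF vecs(4) cm] del: index_mult_mat_vec)
    also have "(\<Sum>j<N. ?G_a j * ?R_b j) = (?KG * transpose_mat ?KR) $$ (r, c)"
      by (simp add: mult_transpose_entry[OF K(1,3) r cm] krylov_entry[OF vecs(1) r]
          krylov_entry[OF vecs(3) cm] del: index_mult_mat_vec)
    finally show ?thesis
      using r cm by (simp add: K[THEN carrier_matD(1)] K[THEN carrier_matD(2)] del: index_mult_mat(1))
  qed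
  have "- ?C = ?T * (1\<^sub>m q @\<^sub>r 0\<^sub>m p q)"
  proof (rule eq_matI)
    have Cc: "?C \<in> carrier_mat p q"
      by (rule lower_left_carrier) (use cr_psi_c[OF zN] m in simp)
    have Ec: "?T * (1\<^sub>m q @\<^sub>r 0\<^sub>m p q) \<in> carrier_mat p q"
      using Tc m by (intro mult_carrier_mat[of _ p m]) auto
    show "dim_row (- ?C) = dim_row (?T * (1\<^sub>m q @\<^sub>r 0\<^sub>m p q))"
      "dim_col (- ?C) = dim_col (?T * (1\<^sub>m q @\<^sub>r 0\<^sub>m p q))"
      using Cc Ec by auto
    fix r c assume "r < dim_row (?T * (1\<^sub>m q @\<^sub>r 0\<^sub>m p q))" "c < dim_col (?T * (1\<^sub>m q @\<^sub>r 0\<^sub>m p q))"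
    then have rc: "r < p" "c < q"
      using Ec by auto
    then have "(- ?C) $$ (r, c) = - (?C $$ (r, c))"
      using Cc by simp
    with entry[OF rc] show "(- ?C) $$ (r, c) = (?T * (1\<^sub>m q @\<^sub>r 0\<^sub>m p q)) $$ (r, c)"
      using mult_identity_over_zero_entry[OF Tc[unfolded m] rc] by simp
  qed
  then show ?thesis
    by (simp add: N_def q_def)
qed

end
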